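(* Neither of the simple 4-regular planar graphs $H_1$ and $H_2$ on 68 vertices (defined in the context) is circle representable.
   Context: **Circle representations.** A *circle representation* of a 4-regular planar (multi)graph $G$ is a collection of circles embedded in $\mathbb{R}^2$ such that each point of the plane belongs to at most two circles, the set of points belonging to exactly two circles is in bijective correspondence with the vertex set of $G$, and the circular arcs between those points (the arcs into which these points divide the circles) correspond to the edge (multi)set of $G$, an arc corresponding to an edge joining the vertices represented by the endpoints of the arc. A point in the intersection of two circles is a *touching* point if it is the only point at which those circles intersect, and a *crossing* point if it is one of the two points at which they intersect. A graph is *circle representable* if it admits a circle representation. **The base multigraph $M$.** $M$ has 12 vertices $v_1,\dots,v_8,a,b,c,d$. Its edges are the edges of the 8-cycle $v_1v_2\cdots v_8v_1$ (each with multiplicity one), together with the following edges, each with multiplicity two: $av_1, av_4$; $bv_2, bv_7$; $cv_3, cv_6$; $dv_5, dv_8$. Each of these eight pairs of parallel edges is called a digon. $M$ is 4-regular and planar. **The graph $H_1$** (octahedral mini-gadgets). For each of the eight digons of $M$, with endpoints $x,y$, replace one of its two parallel edges by a path $x\,u\,y$ through a new vertex $u$; then add six further new vertices forming a copy of the octahedron graph $K_{2,2,2}$ with one edge $pq$ deleted, and add the edges $up$ and $uq$. **The graph $H_2$** (octahedral mini-bigadgets). For each of the eight digons of $M$, with endpoints $x,y$, replace one of its two parallel edges by a path $x\,u\,u'\,y$ through two new vertices $u,u'$; then add five further new vertices $h,c_1,c_2,c_3,c_4$ with edges $c_1c_2,c_2c_3,c_3c_4,c_4c_1$ and $hc_1,hc_2,hc_3,hc_4$,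 and add the edges $uc_1,uc_2,u'c_3,u'c_4$. In both constructions the new vertices for different digons are distinct. Both graphs are simple, 4-regular and planar, with 68 vertices. *)

theory Defs
  imports "HOL-Analysis.Analysis" "HOL-Library.Multiset"
begin

section \<open>Multigraphs\<close>

text \<open>An edge is represented by the set of its endpoints (a singleton for a loop); parallel
  edges are repeated elements of the multiset of edges.\<close>

record 'v multigraph =
  verts :: "'v set"
  edges :: "'v set multiset"

definition simple_graph :: "'v multigraph \<Rightarrow> bool" where
  "simple_graph G \<longleftrightarrow> finite (verts G) \<and>
     (\<forall>e. e \<in># edges G \<longrightarrow> e \<subseteq> verts G \<and> card e = 2 \<and> count (edges G) e = 1)"

text \<open>The second summand makes loops count twice.\<close>

definition degree :: "'v multigraph \<Rightarrow> 'v \<Rightarrow> nat" where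
  "degree G v = size {#e \<in># edges G. v \<in> e#} + size {#e \<in># edges G. e = {v}#}"

definition regular :: "nat \<Rightarrow> 'v multigraph \<Rightarrow> bool" where
  "regular k G \<longleftrightarrow> (\<forall>v\<in>verts G. degree G v = k)"

text \<open>A plane drawing consists of distinct points \<open>p v\<close> for the vertices and of a set \<open>\<Gamma>\<close> of
  simple curves for the edges (a loop may be drawn as a closed curve) that do not meet each other
  or the vertex points except at their ends. The last condition says that the curves correspond
  bijectively to the edges, with multiplicity, each curve joining the points that represent the
  ends of its edge.\<close>

definition curve_interior :: "(real \<Rightarrow> real^2) \<Rightarrow> (real^2) set" where
  "curve_interior \<gamma> = path_image \<gamma> - {pathstart \<gamma>, pathfinish \<gamma>}"

definition planar :: "'v multigraph \<Rightarrow> bool" where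
  "planar G \<longleftrightarrow> (\<exists>(p :: 'v \<Rightarrow> real^2) \<Gamma>.
     inj_on p (verts G) \<and> finite \<Gamma> \<and>
     (\<forall>\<gamma>\<in>\<Gamma>. simple_path \<gamma> \<and> curve_interior \<gamma> \<inter> p ` verts G = {}) \<and>
     (\<forall>\<gamma>\<in>\<Gamma>. \<forall>\<delta>\<in>\<Gamma>. \<gamma> \<noteq> \<delta> \<longrightarrow> curve_interior \<gamma> \<inter> curve_interior \<delta> = {}) \<and>
     image_mset (\<lambda>\<gamma>. {pathstart \<gamma>, pathfinish \<gamma>}) (mset_set \<Gamma>) = image_mset ((`) p) (edges G))"


section \<open>Circle representations\<close>

definition is_circle :: "(real^2) set \<Rightarrow> bool" where
  "is_circle C \<longleftrightarrow> (\<exists>c r. r > 0 \<and> C = sphere c r)"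

definition circles_through :: "(real^2) set set \<Rightarrow> real^2 \<Rightarrow> (real^2) set set" where
  "circles_through \<C> x = {C \<in> \<C>. x \<in> C}"

definition double_points :: "(real^2) set set \<Rightarrow> (real^2) set" where
  "double_points \<C> = {x. card (circles_through \<C> x) = 2}"

text \<open>The open arcs into which the double points divide the circles. A circle without double
  points is not divided and contributes no arc. The difference \<open>closure A - A\<close> consists of the
  endpoints of the open arc \<open>A\<close>; it is a singleton if the circle carries only one double point,
  so that the arc represents a loop.\<close>

definition arcs :: "(real^2) set set \<Rightarrow> (real^2) set set" where
  "arcs \<C> = (\<Union>C \<in> {C \<in> \<C>. C \<inter> double_points \<C> \<noteq> {}}. components (C - double_points \<C>))"

definition arc_ends :: "(real^2) set \<Rightarrow> (real^2) set" where
  "arc_ends A = closure A - A"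

text \<open>The map \<open>p\<close> is the correspondence between vertices and double points. The last two conditions
  say that the arcs correspond bijectively to the edges, with multiplicity, each arc joining the
  points that represent the ends of its edge. (Finiteness is required because \<open>mset_set\<close> is empty
  on infinite sets.)\<close>

definition circle_representation ::
    "'v multigraph \<Rightarrow> (real^2) set set \<Rightarrow> ('v \<Rightarrow> real^2) \<Rightarrow> bool" where
  "circle_representation G \<C> p \<longleftrightarrow>
     (\<forall>C\<in>\<C>. is_circle C) \<and>
     (\<forall>x. finite (circles_through \<C> x) \<and> card (circles_through \<C> x) \<le> 2) \<and>
     bij_betw p (verts G) (double_points \<C>) \<and>
     finite (arcs \<C>) \<and>
     image_mset arc_ends (mset_set (arcs \<C>)) = image_mset ((`) p) (edges G)"

definition circle_representable :: "'v multigraph \<Rightarrow> bool" where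
  "circle_representable G \<longleftrightarrow> (\<exists>\<C> p. circle_representation G \<C> p)"


section \<open>The base multigraph\<close>

datatype mvertex = V1 | V2 | V3 | V4 | V5 | V6 | V7 | V8 | Va | Vb | Vc | Vd

definition digons :: "(mvertex \<times> mvertex) list" where
  "digons = [(Va, V1), (Va, V4), (Vb, V2), (Vb, V7), (Vc, V3), (Vc, V6), (Vd, V5), (Vd, V8)]"

definition digon_edges :: "mvertex set multiset" where
  "digon_edges = image_mset (\<lambda>(x, y). {x, y}) (mset digons)"

definition base_M :: "mvertex multigraph" where
  "base_M = \<lparr> verts = UNIV,
         edges = {# {V1, V2}, {V2, V3}, {V3, V4}, {V4, V5}, {V5, V6}, {V6, V7}, {V7, V8}, {V8, V1} #}
                 + repeat_mset 2 digon_edges \<rparr>"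


section \<open>Replacing digon edges by gadgets\<close>

text \<open>\<open>New d g\<close> is the copy, belonging to the digon \<open>d\<close>, of the gadget vertex \<open>g\<close>.\<close>

datatype 'g hvertex = Base mvertex | New "mvertex \<times> mvertex" 'g

text \<open>One of the two parallel edges of each digon is removed; \<open>gad x y n\<close> is the multiset of edges
  inserted instead of an edge between \<open>x\<close> and \<open>y\<close>, where \<open>n g\<close> is the new vertex for the gadget
  vertex \<open>g\<close>.\<close>

definition replace_digons ::
    "('g hvertex \<Rightarrow> 'g hvertex \<Rightarrow> ('g \<Rightarrow> 'g hvertex) \<Rightarrow> 'g hvertex set multiset)
      \<Rightarrow> 'g hvertex multigraph" where
  "replace_digons gad =
     \<lparr> verts = Base ` verts base_M \<union> {New d g | d g. d \<in> set digons},
       edges = image_mset ((`) Base) (edges base_M - digon_edges)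
               + (\<Sum>(x, y)\<leftarrow>digons. gad (Base x) (Base y) (New (x, y))) \<rparr>"

text \<open>The octahedron has the three pairs of antipodal vertices \<open>Op, Op'\<close>, \<open>Oq, Oq'\<close> and \<open>Or, Or'\<close>;
  its edge between \<open>Op\<close> and \<open>Oq\<close> is missing.\<close>

datatype octa_vertex = Ou | Op | Op' | Oq | Oq' | Or | Or'

definition octa_gadget :: "'v \<Rightarrow> 'v \<Rightarrow> (octa_vertex \<Rightarrow> 'v) \<Rightarrow> 'v set multiset" where
  "octa_gadget x y n =
     {# {x, n Ou}, {n Ou, y} #} +
     {# {n Op, n Oq'}, {n Op', n Oq}, {n Op', n Oq'},
        {n Op, n Or}, {n Op, n Or'}, {n Op', n Or}, {n Op', n Or'},
        {n Oq, n Or}, {n Oq, n Or'}, {n Oq', n Or}, {n Oq', n Or'} #} +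
     {# {n Ou, n Op}, {n Ou, n Oq} #}"

datatype bi_vertex = Bu | Bu' | Bh | Bc1 | Bc2 | Bc3 | Bc4

definition bi_gadget :: "'v \<Rightarrow> 'v \<Rightarrow> (bi_vertex \<Rightarrow> 'v) \<Rightarrow> 'v set multiset" where
  "bi_gadget x y n =
     {# {x, n Bu}, {n Bu, n Bu'}, {n Bu', y} #} +
     {# {n Bc1, n Bc2}, {n Bc2, n Bc3}, {n Bc3, n Bc4}, {n Bc4, n Bc1} #} +
     {# {n Bh, n Bc1}, {n Bh, n Bc2}, {n Bh, n Bc3}, {n Bh, n Bc4} #} +
     {# {n Bu, n Bc1}, {n Bu, n Bc2}, {n Bu', n Bc3}, {n Bu', n Bc4} #}"

definition H1 :: "octa_vertex hvertex multigraph" where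
  "H1 = replace_digons octa_gadget"

definition H2 :: "bi_vertex hvertex multigraph" where
  "H2 = replace_digons bi_gadget"

end

theory Submission imports Defs begin

text \<open>The edges between a gadget and the rest of the graph that are incident to \<open>x\<close> and \<open>y\<close> form a
  two-edge cut, so a circle that uses one of them also uses the other, and every gadget behaves like
  a parallel edge. If the two strands of a digon at \<open>a\<close> lay on different circles, these circles would
  share three points. So each of the eight digons is a circle of its own, the 8-cycle is a circle \<open>O\<close>,
  the digon circles touch \<open>O\<close> at \<open>v\<^sub>1, \<dots>, v\<^sub>8\<close>, and they touch each other in the four pairs
  \<open>(1,4), (2,7), (3,6), (5,8)\<close> and are disjoint otherwise. Send \<open>O\<close> to a line, on which the eight
  points become \<open>x\<^sub>1 < \<dots> < x\<^sub>8\<close>, and let \<open>m\<^sub>i\<close> be the suitably normalised signed curvatures. Two of the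
  circles touch iff \<open>m\<^sub>i m\<^sub>j (x\<^sub>i - x\<^sub>j)\<^sup>2 = 4\<close>, and they are disjoint iff this number is greater than 4 or
  negative. Circles belonging to crossing pairs therefore lie on different sides of \<open>O\<close>, the pairs
  \<open>(1,4), (5,8)\<close> on one side and \<open>(2,7), (3,6)\<close> on the other, and the two sides impose contradictory
  bounds on cross ratios.\<close>

section \<open>Circles tangent to a common circle\<close>

text \<open>A representation only specifies arcs and their ends, so what a circle does at a vertex
  has to be recovered. Every circle through a vertex contains exactly two of the edges there,
  because a circle with a single double point would give a loop. By double counting, each circle
  then meets every edge cut an even number of times; this is the reason behind the claim on two-edge
  cuts.

  The contradiction comes from one function of an interval [a, b] around [x4, x5], the cross ratio
  (x5 - x4)(b - a) / ((x4 - a)(b - x5)), which grows when the interval shrinks. The pairs (1,4),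
  (5,8), together with the separated pairs (1,8), (4,5), make it greater than 1 for [x1, x8]; the
  pairs (2,7), (3,6), together with (2,3), (6,7), make it less than 1 for the smaller interval
  [x2, x7].

  The order x1 < ... < x8 results from projecting from a point of the arc between \<open>V8\<close>
  and \<open>V1\<close>. Simplicity, regularity and planarity are read off a straight-line drawing
  with integer coordinates, by evaluation.\<close>

lemma cross_ratio_greater:
  fixes a b c d ma mb mc md :: real
  assumes "ma * mb * (a - b)\<^sup>2 = 4" "mc * md * (c - d)\<^sup>2 = 4"
    and "ma * mc * (a - c)\<^sup>2 > 4" "mb * md * (b - d)\<^sup>2 > 4"
  shows "\<bar>a - b\<bar> * \<bar>c - d\<bar> < \<bar>a - c\<bar> * \<bar>b - d\<bar>"
proof -
  let ?M = "ma * mb * mc * md"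
  \<comment> \<open>Multiplying the two equations and multiplying the two inequalities produces the
    same factor \<open>?M\<close>, which then cancels.\<close>
  have eq: "?M * ((a - b) * (c - d))\<^sup>2 = 16"
  proof -
    have "?M * ((a - b) * (c - d))\<^sup>2 = (ma * mb * (a - b)\<^sup>2) * (mc * md * (c - d)\<^sup>2)"
      by (simp add: power_mult_distrib)
    then show ?thesis by (simp only: assms)
  qed
  have gt: "?M * ((a - c) * (b - d))\<^sup>2 > 16"
  proof -
    have "4 * 4 < (ma * mc * (a - c)\<^sup>2) * (mb * md * (b - d)\<^sup>2)"
      using assms by (intro mult_strict_mono) auto
    then show ?thesis by (simp add: power_mult_distrib mult_ac)
  qed
  have "?M > 0"
    using eq by (smt (verit) zero_le_power2 mult_nonpos_nonneg)
  then have "((a - b) * (c - d))\<^sup>2 < ((a - c) * (b - d))\<^sup>2"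
    using eq gt by (smt (verit) mult_le_cancel_left_pos)
  then show ?thesis
    by (metis abs_mult power2_less_imp_less abs_ge_zero power2_abs mult_nonneg_nonneg)
qed

lemma separated_pos_gt:
  fixes a b d :: real
  assumes "a * b > 0" "a * b * d\<^sup>2 > 4 \<or> a * b * d\<^sup>2 < 0"
  shows "a * b * d\<^sup>2 > 4"
  using assms by (metis less_imp_le mult_nonneg_nonneg not_less zero_le_power2)

text \<open>If \<open>mp\<close> and \<open>mq\<close> had the same sign, all four would, and
  \<open>cross_ratio_greater\<close> would bound pr times qs by pq times rs. But for interleaved
  pairs pq lies inside pr, and rs inside qs.\<close>

lemma crossing_pairs_opposite_signs:
  fixes p q r s mp mq mr ms :: real
  assumes "p < q" "q < r" "r < s"
    and "mp * mr * (p - r)\<^sup>2 = 4" "mq * ms * (q - s)\<^sup>2 = 4"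
    and pq: "mp * mq * (p - q)\<^sup>2 > 4 \<or> mp * mq * (p - q)\<^sup>2 < 0"
    and rs: "mr * ms * (r - s)\<^sup>2 > 4 \<or> mr * ms * (r - s)\<^sup>2 < 0"
  shows "mp * mq < 0"
proof (rule ccontr)
  assume "\<not> mp * mq < 0"
  then have pos: "mp * mq > 0"
    using assms(4,5) by (metis linorder_neqE_linordered_idom mult_eq_0_iff zero_neq_numeral)
  have "mp * mr > 0" "mq * ms > 0"
    using assms(4,5) by (smt (verit) zero_le_power2 mult_nonpos_nonneg)+
  then have "mr * ms > 0" using pos
    by (smt (verit) zero_less_mult_iff)
  then have "\<bar>p - r\<bar> * \<bar>q - s\<bar> < \<bar>p - q\<bar> * \<bar>r - s\<bar>"
    using assms pos by (intro cross_ratio_greater separated_pos_gt) auto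
  moreover have "\<bar>p - q\<bar> * \<bar>r - s\<bar> \<le> \<bar>p - r\<bar> * \<bar>q - s\<bar>"
    using assms(1-3) by (intro mult_mono) auto
  ultimately show False by simp
qed

lemma no_eight_points_on_line:
  fixes x m :: "nat \<Rightarrow> real"
  assumes mono: "\<And>i. i \<in> {1..7} \<Longrightarrow> x i < x (Suc i)"
    and tan: "\<And>i j. (i, j) \<in> {(1,4), (5,8), (2,7), (3,6)} \<Longrightarrow> m i * m j * (x i - x j)\<^sup>2 = 4"
    and dis: "\<And>i j. i \<in> {1..8} \<Longrightarrow> j \<in> {1..8} \<Longrightarrow> i < j \<Longrightarrow> (i, j) \<notin> {(1,4), (5,8), (2,7), (3,6)} \<Longrightarrow>
            m i * m j * (x i - x j)\<^sup>2 > 4 \<or> m i * m j * (x i - x j)\<^sup>2 < 0"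
  shows False
proof -
  have lt: "x 1 < x 2" "x 2 < x 3" "x 3 < x 4" "x 4 < x 5" "x 5 < x 6" "x 6 < x 7" "x 7 < x 8"
    using mono[of 1] mono[of 2] mono[of 3] mono[of 4] mono[of 5] mono[of 6] mono[of 7]
    by (simp_all add: eval_nat_numeral)
  \<comment> \<open>Three crossings fix all signs: (1,4) with (2,7), (1,4) with (3,6), and (2,7)
    with (5,8).\<close>
  have opp: "m 1 * m 2 < 0" "m 1 * m 3 < 0" "m 2 * m 5 < 0"
    using lt crossing_pairs_opposite_signs[of "x 1" "x 2" "x 4" "x 7" "m 1" "m 4" "m 2" "m 7"]
      crossing_pairs_opposite_signs[of "x 1" "x 3" "x 4" "x 6" "m 1" "m 4" "m 3" "m 6"]
      crossing_pairs_opposite_signs[of "x 2" "x 5" "x 7" "x 8" "m 2" "m 7" "m 5" "m 8"]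
    by (simp_all add: tan dis)
  have same: "m i * m j > 0" if "(i, j) \<in> {(1,4), (5,8), (2,7), (3,6)}" for i j
    using tan[OF that] by (smt (verit) zero_le_power2 mult_nonpos_nonneg)
  have pos: "m 1 * m 8 > 0" "m 4 * m 5 > 0" "m 2 * m 3 > 0" "m 6 * m 7 > 0"
    using opp same[of 1 4] same[of 5 8] same[of 2 7] same[of 3 6]
    by (auto simp: mult_less_0_iff zero_less_mult_iff)
  have gt: "m i * m j * (x i - x j)\<^sup>2 > 4" if "(i, j) \<in> {(1,8), (4,5), (2,3), (6,7)}" for i j
    using dis[of i j] that pos by (intro separated_pos_gt) auto
  have ad: "(x 4 - x 1) * (x 8 - x 5) < (x 8 - x 1) * (x 5 - x 4)"
    using cross_ratio_greater[of "m 1" "m 4" "x 1" "x 4" "m 8" "m 5" "x 8" "x 5"]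
      tan[of 1 4] tan[of 5 8] gt[of 1 8] gt[of 4 5] lt
    by (simp add: mult.commute power2_commute)
  have bc: "(x 7 - x 2) * (x 6 - x 3) < (x 3 - x 2) * (x 7 - x 6)"
    using cross_ratio_greater[of "m 2" "m 7" "x 2" "x 7" "m 3" "m 6" "x 3" "x 6"]
      tan[of 2 7] tan[of 3 6] gt[of 2 3] gt[of 6 7] lt
    by (simp add: mult.commute power2_commute)
  \<comment> \<open>Replacing \<open>x 3\<close> by \<open>x 4\<close> and \<open>x 6\<close> by
    \<open>x 5\<close> turns \<open>bc\<close> into a statement about the inner interval [x4, x5],
    which also occurs in \<open>ad\<close>.\<close>
  have "(x 3 - x 2) * (x 7 - x 6) \<le> (x 4 - x 2) * (x 7 - x 5)"
    using lt by (intro mult_mono) auto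
  moreover have "(x 7 - x 2) * (x 5 - x 4) \<le> (x 7 - x 2) * (x 6 - x 3)"
    using lt by (intro mult_mono) auto
  ultimately have s1: "(x 7 - x 2) * (x 5 - x 4) < (x 4 - x 2) * (x 7 - x 5)"
    using bc by linarith
  \<comment> \<open>The two sides differ by (b - a)(c - q). With \<open>q\<close> an end of [x4, x5]
    this is the monotonicity of the cross ratio when one end of the outer interval moves
    inwards.\<close>
  have shrink: "(q - b) * (c - a) \<le> (q - a) * (c - b)" if "a \<le> b" "c \<ge> q" for a b c q :: real
  proof -
    have "0 \<le> (b - a) * (c - q)" using that by simp
    then show ?thesis by (simp add: algebra_simps)
  qed
  have s2: "(x 4 - x 2) * (x 8 - x 1) \<le> (x 4 - x 1) * (x 8 - x 2)"
    using lt by (intro shrink) auto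
  have s3: "(x 7 - x 5) * (x 8 - x 2) \<le> (x 8 - x 5) * (x 7 - x 2)"
    using shrink[of "- x 8" "- x 7" "- x 5" "- x 2"] lt by (simp add: algebra_simps)
  let ?p = "\<lambda>i j. x j - x i"
  have "?p 2 7 * ?p 4 5 * (?p 1 8 * ?p 2 8) < ?p 2 4 * ?p 5 7 * (?p 1 8 * ?p 2 8)"
    using s1 lt by (intro mult_strict_right_mono mult_pos_pos) auto
  also have "\<dots> = (?p 2 4 * ?p 1 8) * (?p 5 7 * ?p 2 8)"
    by simp
  also have "\<dots> \<le> (?p 1 4 * ?p 2 8) * (?p 5 8 * ?p 2 7)"
    using lt by (intro mult_mono[OF s2 s3]) auto
  also have "\<dots> = (?p 1 4 * ?p 5 8) * (?p 2 8 * ?p 2 7)"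
    by simp
  also have "\<dots> < (?p 1 8 * ?p 4 5) * (?p 2 8 * ?p 2 7)"
    using ad lt by (intro mult_strict_right_mono mult_pos_pos) auto
  finally show False by (simp add: mult_ac)
qed

section \<open>Mutual position of two circles\<close>

lemma dist_square_inner: "(dist a p)\<^sup>2 = (p - a) \<bullet> (p - a)" for a p :: "'a::real_inner"
  by (metis dist_commute dist_norm power2_norm_eq_inner)

lemma sphere_not_singleton:
  fixes o' p :: "'a::real_normed_vector"
  assumes "R > 0"
  shows "sphere o' R \<noteq> {p}"
proof
  assume eq: "sphere o' R = {p}"
  then have "dist o' p = R" by auto
  then have "2 *\<^sub>R o' - p \<in> sphere o' R"
    by (simp add: dist_norm scaleR_2 norm_minus_commute)
  then have "2 *\<^sub>R o' - p = p" using eq by blast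
  then have "2 *\<^sub>R o' = 2 *\<^sub>R p" by (simp add: scaleR_2 algebra_simps)
  then have "o' = p" by (simp only: scaleR_cancel_left) simp
  with \<open>dist o' p = R\<close> \<open>R > 0\<close> show False by simp
qed

text \<open>Otherwise the reflection of \<open>p\<close> in the line of centers is a second common point.\<close>

lemma tangent_spheres_collinear:
  fixes a b p :: "'a::real_inner"
  assumes r: "r > 0" and tan: "sphere a r \<inter> sphere b s = {p}"
  shows "a \<noteq> b" "\<exists>\<mu>. p = a + \<mu> *\<^sub>R (b - a)"
proof -
  have p: "dist a p = r" "dist b p = s" using tan by auto
  show ab: "a \<noteq> b"
  proof
    assume "a = b"
    with p have "sphere a r \<inter> sphere b s = sphere a r" by auto
    with tan sphere_not_singleton[OF r] show False by metis
  qed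
  define u where "u = b - a"
  define \<mu> where "\<mu> = ((p - a) \<bullet> u) / (u \<bullet> u)"
  define q where "q = 2 *\<^sub>R (a + \<mu> *\<^sub>R u) - p"
  have uu: "u \<bullet> u \<noteq> 0" using ab by (simp add: u_def)
  have refl: "dist (a + t *\<^sub>R u) q = dist (a + t *\<^sub>R u) p" for t
  proof -
    have \<mu>: "\<mu> * (u \<bullet> u) = (p - a) \<bullet> u" using uu by (simp add: \<mu>_def)
    have e: "((p - a) \<bullet> u) = p \<bullet> u - a \<bullet> u" by (simp add: inner_diff_left)
    have "(a + t *\<^sub>R u - q) \<bullet> (a + t *\<^sub>R u - q) = (a + t *\<^sub>R u - p) \<bullet> (a + t *\<^sub>R u - p)
       + 4 * (\<mu> - t) * (\<mu> * (u \<bullet> u) - (p - a) \<bullet> u)"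
      by (simp add: q_def algebra_simps inner_commute scaleR_2)
    then show ?thesis by (simp add: \<mu> dist_norm norm_eq_sqrt_inner)
  qed
  have "q \<in> sphere a r \<inter> sphere b s"
    using refl[of 0] refl[of 1] p by (simp add: u_def)
  then have "q = p" using tan by blast
  then have "2 *\<^sub>R p = 2 *\<^sub>R (a + \<mu> *\<^sub>R u)" by (simp add: q_def scaleR_2 algebra_simps)
  then have "p = a + \<mu> *\<^sub>R u" by (simp only: scaleR_cancel_left) simp
  then show "\<exists>\<mu>. p = a + \<mu> *\<^sub>R (b - a)" unfolding u_def by blast
qed

text \<open>The touching point lies on the line of centers, so both radii are multiples of the
  distance d of the centers: r = |\<mu>| d and s = |1 - \<mu>| d. The signs of \<mu> and 1 - \<mu>
  decide between external and internal tangency.\<close>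

lemma tangent_spheres_dist:
  fixes a b p :: "'a::real_inner"
  assumes r: "r > 0" and tan: "sphere a r \<inter> sphere b s = {p}"
  shows "(dist a b)\<^sup>2 = (r + s)\<^sup>2 \<or> (dist a b)\<^sup>2 = (r - s)\<^sup>2"
proof -
  obtain \<mu> where \<mu>: "p = a + \<mu> *\<^sub>R (b - a)"
    using tangent_spheres_collinear[OF assms] by blast
  have "a - p = - (\<mu> *\<^sub>R (b - a))" "b - p = (1 - \<mu>) *\<^sub>R (b - a)"
    using \<mu> by (simp_all add: algebra_simps)
  then have "dist a p = \<bar>\<mu>\<bar> * dist a b" "dist b p = \<bar>1 - \<mu>\<bar> * dist a b"
    by (simp_all add: dist_norm norm_minus_commute)
  then have "r = \<bar>\<mu>\<bar> * dist a b" "s = \<bar>1 - \<mu>\<bar> * dist a b" using tan by auto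
  then have "dist a b = r + s \<or> dist a b = r - s \<or> dist a b = s - r"
    by (auto simp: abs_if algebra_simps)
  then show ?thesis by (auto simp: power2_commute)
qed

definition perp :: "real^2 \<Rightarrow> real^2" where
  "perp v = vector [- v $ 2, v $ 1]"

lemma inner_real2: "(x :: real^2) \<bullet> y = x $ 1 * y $ 1 + x $ 2 * y $ 2"
  by (simp add: inner_vec_def sum_2)

lemma perp_nth [simp]: "perp v $ 1 = - v $ 2" "perp v $ 2 = v $ 1"
  by (simp_all add: perp_def)

lemma inner_perp [simp]: "v \<bullet> perp v = 0" "perp v \<bullet> v = 0" "perp v \<bullet> perp v = v \<bullet> v"
  by (simp_all add: inner_real2)

text \<open>If the distance lay between |r - s| and r + s, there would be a triangle on the centers
  with the other sides r and s, and its apex would be a common point.\<close>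

lemma disjoint_spheres_dist:
  fixes a b :: "real^2"
  assumes r: "r > 0" "s > 0" and dis: "sphere a r \<inter> sphere b s = {}"
  shows "(dist a b)\<^sup>2 > (r + s)\<^sup>2 \<or> (dist a b)\<^sup>2 < (r - s)\<^sup>2"
proof (rule ccontr)
  assume "\<not> ?thesis"
  then have le: "(dist a b)\<^sup>2 \<le> (r + s)\<^sup>2" "(dist a b)\<^sup>2 \<ge> (r - s)\<^sup>2" by auto
  define u where "u = b - a"
  define d2 where "d2 = u \<bullet> u"
  have d2: "(dist a b)\<^sup>2 = d2"
    unfolding d2_def u_def dist_commute[of a b] by (simp add: dist_norm power2_norm_eq_inner)
  have "u \<noteq> 0"
  proof
    assume "u = 0"
    then have "a = b" "d2 = 0" by (auto simp: u_def d2_def)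
    then have "r = s" using le d2 by simp
    with \<open>a = b\<close> dis r have "sphere a r = {}" by simp
    then show False using r by (simp add: sphere_eq_empty)
  qed
  then have pos: "d2 > 0" by (simp add: d2_def)
  \<comment> \<open>In units of \<open>u\<close>, \<open>\<alpha>\<close> is the position of the
    foot of the altitude on the line of centers, and \<open>\<beta>\<close> below is the altitude.
    Its square is nonnegative by the factorisation in Heron's formula.\<close>
  define \<alpha> where "\<alpha> = (d2 + r\<^sup>2 - s\<^sup>2) / (2 * d2)"
  have al: "\<alpha> * (2 * d2) = d2 + r\<^sup>2 - s\<^sup>2" using pos by (simp add: \<alpha>_def)
  have "4 * d2 * (r\<^sup>2 - \<alpha>\<^sup>2 * d2) = 4 * d2 * r\<^sup>2 - (\<alpha> * (2 * d2))\<^sup>2"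
    by (simp add: algebra_simps power2_eq_square)
  also have "\<dots> = ((r + s)\<^sup>2 - d2) * (d2 - (r - s)\<^sup>2)"
    unfolding al by (simp add: algebra_simps power2_eq_square)
  also have "\<dots> \<ge> 0" using le d2 by simp
  finally have nn: "r\<^sup>2 - \<alpha>\<^sup>2 * d2 \<ge> 0" using pos by (simp add: zero_le_mult_iff)
  define \<beta> where "\<beta> = sqrt ((r\<^sup>2 - \<alpha>\<^sup>2 * d2) / d2)"
  have "\<beta>\<^sup>2 = (r\<^sup>2 - \<alpha>\<^sup>2 * d2) / d2" using nn pos by (simp add: \<beta>_def)
  then have be: "\<beta>\<^sup>2 * d2 = r\<^sup>2 - \<alpha>\<^sup>2 * d2" using pos by simp
  define p where "p = a + \<alpha> *\<^sub>R u + \<beta> *\<^sub>R perp u"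
  have "(p - a) \<bullet> (p - a) = \<alpha>\<^sup>2 * d2 + \<beta>\<^sup>2 * d2"
    by (simp add: p_def d2_def inner_add_left inner_add_right power2_eq_square algebra_simps)
  then have ra: "(dist a p)\<^sup>2 = r\<^sup>2"
    using be unfolding dist_square_inner by linarith
  have "p - b = (\<alpha> - 1) *\<^sub>R u + \<beta> *\<^sub>R perp u"
    by (simp add: p_def u_def algebra_simps)
  then have "(p - b) \<bullet> (p - b) =
      ((\<alpha> - 1) *\<^sub>R u + \<beta> *\<^sub>R perp u) \<bullet> ((\<alpha> - 1) *\<^sub>R u + \<beta> *\<^sub>R perp u)"
    by (simp only:)
  also have "\<dots> = (\<alpha> - 1)\<^sup>2 * d2 + \<beta>\<^sup>2 * d2"
    by (simp add: d2_def inner_add_left inner_add_right power2_eq_square algebra_simps)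
  also have "\<dots> = s\<^sup>2"
    using be al by (simp add: power2_eq_square algebra_simps)
  finally have "(dist b p)\<^sup>2 = s\<^sup>2"
    by (simp only: dist_square_inner)
  with ra have "p \<in> sphere a r \<inter> sphere b s" using r by simp
  then show False using dis by blast
qed

text \<open>The intersection lies on the radical line, which contains at most two points of a circle.\<close>

lemma three_common_points_same_circle:
  fixes a b x y z :: "real^2"
  assumes sub: "{x, y, z} \<subseteq> sphere a r \<inter> sphere b s" and ne: "x \<noteq> y" "y \<noteq> z" "x \<noteq> z"
  shows "sphere a r = sphere b s"
proof (cases "a = b")
  case True
  then show ?thesis using sub by auto
next
  case False
  define u where "u = perp (b - a)"
  have u0: "u \<noteq> 0" unfolding u_def using False inner_perp(3)[of "b - a"] by (metis inner_eq_zero_iff right_minus_eq)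
  have on_line: "\<exists>t. q = x + t *\<^sub>R u" if "q \<in> {x, y, z}" for q
  proof -
    have "(q - a) \<bullet> (q - a) = (x - a) \<bullet> (x - a)" "(q - b) \<bullet> (q - b) = (x - b) \<bullet> (x - b)"
      using sub that by (auto simp: dist_norm norm_minus_commute simp flip: power2_norm_eq_inner)
    then have "(q - x) \<bullet> (b - a) = 0"
      by (simp add: algebra_simps inner_commute)
    then have o: "(q - x) $ 1 * (b - a) $ 1 + (q - x) $ 2 * (b - a) $ 2 = 0"
      by (simp add: inner_real2)
    have "\<exists>t. q - x = t *\<^sub>R u"
    proof (cases "(b - a) $ 1 = 0")
      case True
      then have "(b - a) $ 2 \<noteq> 0" using False by (auto simp: vec_eq_iff forall_2)
      with True o have "q - x = (- (q - x) $ 1 / (b - a) $ 2) *\<^sub>R u"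
        by (simp add: vec_eq_iff forall_2 u_def field_simps)
      then show ?thesis by blast
    next
      case nz: False
      with o have "q - x = ((q - x) $ 2 / (b - a) $ 1) *\<^sub>R u"
        by (simp add: vec_eq_iff forall_2 u_def field_simps)
      then show ?thesis by blast
    qed
    then show ?thesis by (metis add.commute diff_add_cancel)
  qed
  \<comment> \<open>On the radical line the equation of the circle is quadratic in the parameter and
    has the root 0 at \<open>x\<close>. So \<open>y\<close> and \<open>z\<close> both belong to the
    other root.\<close>
  have param: "t = 0 \<or> t * (u \<bullet> u) = - 2 * ((x - a) \<bullet> u)" if "x + t *\<^sub>R u \<in> {x, y, z}" for t
  proof -
    have "(x + t *\<^sub>R u - a) \<bullet> (x + t *\<^sub>R u - a) = (x - a) \<bullet> (x - a)"
      using sub that by (auto simp: dist_norm norm_minus_commute simp flip: power2_norm_eq_inner)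
    then have "t * (t * (u \<bullet> u) + 2 * ((x - a) \<bullet> u)) = 0"
      by (simp add: algebra_simps inner_commute)
    then show ?thesis by auto
  qed
  obtain t t' where tt: "y = x + t *\<^sub>R u" "z = x + t' *\<^sub>R u"
    using on_line by blast
  then have "t \<noteq> 0" "t' \<noteq> 0" "t \<noteq> t'" using ne by auto
  moreover from this have "t * (u \<bullet> u) = t' * (u \<bullet> u)" using param[of t] param[of t'] tt by simp
  ultimately have "t * (u \<bullet> u) = t' * (u \<bullet> u)" "t \<noteq> t'" by auto
  with u0 show ?thesis by simp
qed

section \<open>Stereographic projection from a point of a circle\<close>

definition stereo :: "real^2 \<Rightarrow> real^2 \<Rightarrow> real^2 \<Rightarrow> real" where
  "stereo c w p = ((p - w) \<bullet> perp (w - c)) / ((p - w) \<bullet> (p - w))"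

text \<open>The inversion at \<open>w\<close> whose power is the squared radius maps the circle to
  the line of the points w + x perp(w - c) - (1/2)(w - c), and \<open>stereo\<close> reads off x.
  Inverting back divides by 1/4 + x^2, where 1/4 is the square of the fixed coordinate 1/2.\<close>

definition stereo_inv :: "real^2 \<Rightarrow> real^2 \<Rightarrow> real \<Rightarrow> real^2" where
  "stereo_inv c w x = w + (1 / (1/4 + x\<^sup>2)) *\<^sub>R (x *\<^sub>R perp (w - c) - (1/2) *\<^sub>R (w - c))"

lemma stereo_denominator_pos: "1/4 + (x::real)\<^sup>2 > 0"
  by (smt (verit) zero_le_power2 divide_pos_pos)

lemma stereo_inv_inner:
  "(stereo_inv c w x - w) \<bullet> (stereo_inv c w y - w) =
     (1/4 + x * y) * ((w - c) \<bullet> (w - c)) / ((1/4 + x\<^sup>2) * (1/4 + y\<^sup>2))"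
proof -
  define v where "v = w - c"
  have "(x *\<^sub>R perp v - (1/2) *\<^sub>R v) \<bullet> (y *\<^sub>R perp v - (1/2) *\<^sub>R v) = (1/4 + x * y) * (v \<bullet> v)"
    by (simp add: inner_diff_left inner_diff_right algebra_simps)
  then show ?thesis by (simp add: stereo_inv_def v_def)
qed

lemma stereo_inv_self_inner:
  "(stereo_inv c w x - w) \<bullet> (stereo_inv c w x - w) = ((w - c) \<bullet> (w - c)) / (1/4 + x\<^sup>2)"
  using stereo_denominator_pos[of x] by (simp add: stereo_inv_inner power2_eq_square)

text \<open>Chords become differences of coordinates, up to one weight for each end. Such weights
  can be absorbed into the curvatures, as is done in the definition of \<open>m\<close> in
  \<open>no_eight_tangent_circles\<close>.\<close>

lemma dist_stereo_inv:
  assumes "dist c w = R"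
  shows "(dist (stereo_inv c w x) (stereo_inv c w y))\<^sup>2
           = R\<^sup>2 * (x - y)\<^sup>2 / ((1/4 + x\<^sup>2) * (1/4 + y\<^sup>2))"
proof -
  let ?p = "stereo_inv c w x - w" and ?q = "stereo_inv c w y - w"
  have R: "(w - c) \<bullet> (w - c) = R\<^sup>2"
    using assms by (simp add: dist_norm norm_minus_commute flip: power2_norm_eq_inner)
  have "(dist (stereo_inv c w x) (stereo_inv c w y))\<^sup>2 = (?p - ?q) \<bullet> (?p - ?q)"
    by (simp add: dist_norm power2_norm_eq_inner)
  also have "\<dots> = ?p \<bullet> ?p + ?q \<bullet> ?q - 2 * (?p \<bullet> ?q)"
    by (simp add: algebra_simps inner_commute)
  also have "\<dots> = R\<^sup>2 / (1/4 + x\<^sup>2) + R\<^sup>2 / (1/4 + y\<^sup>2)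
                  - 2 * ((1/4 + x * y) * R\<^sup>2 / ((1/4 + x\<^sup>2) * (1/4 + y\<^sup>2)))"
    unfolding stereo_inv_self_inner by (simp only: stereo_inv_inner R)
  also have "\<dots> = R\<^sup>2 * (x - y)\<^sup>2 / ((1/4 + x\<^sup>2) * (1/4 + y\<^sup>2))"
  proof -
    define X Y where "X = 1/4 + x\<^sup>2" and "Y = 1/4 + y\<^sup>2"
    have nz: "X \<noteq> 0" "Y \<noteq> 0"
      using stereo_denominator_pos[of x] stereo_denominator_pos[of y] by (auto simp: X_def Y_def)
    define D where "D = (x - y)\<^sup>2"
    have e: "1/4 + x * y = (X + Y - D) / 2"
      by (simp add: X_def Y_def D_def power2_eq_square algebra_simps)
    show ?thesis
      unfolding X_def[symmetric] Y_def[symmetric] D_def[symmetric] e using nz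
      by (simp add: field_simps)
  qed
  finally show ?thesis .
qed

lemma real2_perp_expansion: "(v \<bullet> v) *\<^sub>R p = (p \<bullet> v) *\<^sub>R v + (p \<bullet> perp v) *\<^sub>R perp v"
  by (simp add: vec_eq_iff forall_2 inner_real2 algebra_simps)

lemma homeomorphism_stereo:
  assumes R: "R > 0" and w: "w \<in> sphere c R"
  shows "homeomorphism (sphere c R - {w}) UNIV (stereo c w) (stereo_inv c w)"
proof -
  define v where "v = w - c"
  have v: "v \<bullet> v = R\<^sup>2"
    using w by (simp add: v_def dist_norm norm_minus_commute flip: power2_norm_eq_inner)
  have nz: "1/4 + x\<^sup>2 \<noteq> 0" for x :: real using stereo_denominator_pos[of x] by simp
  have inv_ne: "stereo_inv c w x \<noteq> w" for x
    using stereo_inv_self_inner[of c w x] v R nz[of x] by (auto simp: v_def[symmetric])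
  have inv_sphere: "stereo_inv c w x \<in> sphere c R" for x
  proof -
    have "(stereo_inv c w x - w) \<bullet> v = - (R\<^sup>2 / (1/4 + x\<^sup>2)) / 2"
      by (simp add: stereo_inv_def v inner_diff_left flip: v_def)
    moreover have "(stereo_inv c w x - w) \<bullet> (stereo_inv c w x - w) = R\<^sup>2 / (1/4 + x\<^sup>2)"
      unfolding stereo_inv_self_inner v_def[symmetric] v ..
    moreover have "stereo_inv c w x - c = (stereo_inv c w x - w) + v" by (simp add: v_def)
    ultimately have "(stereo_inv c w x - c) \<bullet> (stereo_inv c w x - c) = R\<^sup>2"
      by (simp only: inner_add_left inner_add_right inner_commute[of v "stereo_inv c w x - w"] v)
    then have "(dist c (stereo_inv c w x))\<^sup>2 = R\<^sup>2"
      by (simp only: dist_square_inner)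
    then show ?thesis using R by simp
  qed
  have right: "stereo c w (stereo_inv c w x) = x" for x
  proof -
    have "(stereo_inv c w x - w) \<bullet> perp v = x * (R\<^sup>2 / (1/4 + x\<^sup>2))"
      by (simp add: stereo_inv_def v inner_diff_left flip: v_def)
    moreover have "(stereo_inv c w x - w) \<bullet> (stereo_inv c w x - w) = R\<^sup>2 / (1/4 + x\<^sup>2)"
      unfolding stereo_inv_self_inner v_def[symmetric] v ..
    ultimately have "stereo c w (stereo_inv c w x) = x * (R\<^sup>2 / (1/4 + x\<^sup>2)) / (R\<^sup>2 / (1/4 + x\<^sup>2))"
      unfolding stereo_def v_def[symmetric] by (simp only:)
    moreover have "R\<^sup>2 / (1/4 + x\<^sup>2) \<noteq> 0" using R nz[of x] by (metis divide_eq_0_iff power_not_zero less_irrefl)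
    ultimately show ?thesis by (metis nonzero_mult_div_cancel_right)
  qed
  have left: "stereo_inv c w (stereo c w p) = p" if p: "p \<in> sphere c R" "p \<noteq> w" for p
  proof -
    define q where "q = p - w"
    define W where "W = q \<bullet> q"
    define x where "x = stereo c w p"
    have W: "W > 0" using p by (simp add: W_def q_def)
    have qp: "q \<bullet> perp v = x * W" using W by (simp add: x_def stereo_def v_def q_def W_def)
    have "(p - c) \<bullet> (p - c) = R\<^sup>2"
      using p by (simp add: dist_norm norm_minus_commute flip: power2_norm_eq_inner)
    moreover have "p - c = q + v" by (simp add: q_def v_def)
    ultimately have "(q + v) \<bullet> (q + v) = R\<^sup>2" by (simp only:)
    \<comment> \<open>This is the equation of the circle, |q + v| = |v|: after inversion the
      coordinate along \<open>v\<close> is constant.\<close>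
    then have qv: "q \<bullet> v = - W / 2"
      by (simp add: inner_add_left inner_add_right inner_commute[of v q] v W_def)
    have e: "R\<^sup>2 *\<^sub>R q = W *\<^sub>R (x *\<^sub>R perp v - (1/2) *\<^sub>R v)"
      using real2_perp_expansion[of v q] by (simp add: qv qp v scaleR_diff_right mult.commute)
    \<comment> \<open>Pairing \<open>e\<close> with \<open>q\<close> itself determines W = |q|^2
      from the coordinate x alone.\<close>
    have "R\<^sup>2 * W = q \<bullet> (R\<^sup>2 *\<^sub>R q)" by (simp add: W_def)
    also have "\<dots> = W * (W * (1/4 + x\<^sup>2))"
      unfolding e by (simp add: inner_diff_right qv qp power2_eq_square algebra_simps)
    finally have "R\<^sup>2 = W * (1/4 + x\<^sup>2)" using W by simp
    then have "R\<^sup>2 * (1 / (1/4 + x\<^sup>2)) = W" using nz[of x] by simp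
    then have "R\<^sup>2 *\<^sub>R q = R\<^sup>2 *\<^sub>R (stereo_inv c w x - w)"
      unfolding e stereo_inv_def v_def[symmetric] by simp
    then show ?thesis using R by (simp add: x_def q_def)
  qed
  have img: "range (stereo_inv c w) = sphere c R - {w}"
  proof (intro equalityI subsetI)
    fix p assume "p \<in> sphere c R - {w}"
    then have "p = stereo_inv c w (stereo c w p)" using left by auto
    then show "p \<in> range (stereo_inv c w)" by (rule range_eqI)
  qed (use inv_sphere inv_ne in auto)
  show ?thesis
    unfolding homeomorphism_def
  proof (intro conjI ballI)
    show "continuous_on (sphere c R - {w}) (stereo c w)"
      unfolding stereo_def by (intro continuous_intros) auto
    show "continuous_on UNIV (stereo_inv c w)"
      unfolding stereo_inv_def using nz by (intro continuous_intros) auto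
    show "stereo c w ` (sphere c R - {w}) = UNIV"
      using right img by (metis image_image rangeI surj_def image_eqI UNIV_eq_I)
  qed (use left right img in auto)
qed

section \<open>Circles tangent to one fixed circle, and an invariant of pairs of them\<close>

lemma tangent_circle_center:
  fixes c p :: "'a::real_inner"
  assumes R: "R > 0" "r > 0" and tan: "sphere a r \<inter> sphere c R = {p}"
  shows "\<exists>l. l \<noteq> 0 \<and> l \<noteq> 1 \<and> a = c + l *\<^sub>R (p - c) \<and> r = \<bar>1 - l\<bar> * R"
proof -
  have tan': "sphere c R \<inter> sphere a r = {p}" using tan by blast
  have ne: "c \<noteq> a" using tangent_spheres_collinear(1)[OF R(1) tan'] .
  obtain \<mu> where \<mu>: "p = c + \<mu> *\<^sub>R (a - c)"
    using tangent_spheres_collinear(2)[OF R(1) tan'] by blast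
  have p: "dist c p = R" "dist a p = r" using tan by auto
  have "\<mu> \<noteq> 0" using \<mu> p R by auto
  \<comment> \<open>On the line from \<open>c\<close> to \<open>p\<close>, with \<open>p\<close> at
    1, the new center sits at \<open>l\<close>, and 1 - l is its signed radius in units of
    \<open>R\<close>. The circle lies inside the fixed one for 0 < l < 1, outside for l > 1, and
    surrounds it for l < 0; hence l / (1 - l) is positive exactly for circles inside.\<close>
  define l where "l = 1 / \<mu>"
  have a: "a = c + l *\<^sub>R (p - c)" using \<open>\<mu> \<noteq> 0\<close> by (simp add: \<mu> l_def)
  then have "a - p = - ((1 - l) *\<^sub>R (p - c))" by (simp add: algebra_simps)
  then have "dist a p = \<bar>1 - l\<bar> * dist c p"
    by (simp add: dist_norm norm_minus_commute)
  with p have r: "r = \<bar>1 - l\<bar> * R" by simp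
  then have "l \<noteq> 1" using R by auto
  moreover have "l \<noteq> 0" using ne a by auto
  ultimately show ?thesis using a r by blast
qed

text \<open>Law of cosines; as both radius vectors have length \<open>R\<close>, their inner product
  can be traded for the chord from \<open>p\<close> to \<open>q\<close>.\<close>

lemma dist_tangent_centers:
  fixes c p q :: "'a::real_inner"
  assumes "dist c p = R" "dist c q = R"
  shows "(dist (c + l *\<^sub>R (p - c)) (c + k *\<^sub>R (q - c)))\<^sup>2 = R\<^sup>2 * (l - k)\<^sup>2 + l * k * (dist p q)\<^sup>2"
proof -
  define P Q where "P = p - c" and "Q = q - c"
  have PQ: "P \<bullet> P = R\<^sup>2" "Q \<bullet> Q = R\<^sup>2"
    using assms by (auto simp: P_def Q_def dist_norm norm_minus_commute simp flip: power2_norm_eq_inner)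
  have "(dist (c + l *\<^sub>R P) (c + k *\<^sub>R Q))\<^sup>2 = (l *\<^sub>R P - k *\<^sub>R Q) \<bullet> (l *\<^sub>R P - k *\<^sub>R Q)"
    by (simp add: dist_norm power2_norm_eq_inner)
  also have "\<dots> = l * l * (P \<bullet> P) + k * k * (Q \<bullet> Q) - 2 * l * k * (P \<bullet> Q)"
    by (simp only: inner_diff_left inner_diff_right inner_commute[of Q P] inner_scaleR_left
        inner_scaleR_right) (simp add: algebra_simps)
  also have "\<dots> = R\<^sup>2 * (l - k)\<^sup>2 + l * k * (P \<bullet> P + Q \<bullet> Q - 2 * (P \<bullet> Q))"
    unfolding PQ by (simp add: power2_eq_square algebra_simps)
  also have "P \<bullet> P + Q \<bullet> Q - 2 * (P \<bullet> Q) = (P - Q) \<bullet> (P - Q)"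
    by (simp only: inner_diff_left inner_diff_right inner_commute[of Q P])
  also have "\<dots> = (dist p q)\<^sup>2"
    by (simp add: dist_norm power2_norm_eq_inner P_def Q_def)
  finally show ?thesis
    unfolding P_def Q_def .
qed

text \<open>A change of direction at \<open>x (Suc i)\<close> would place one of its two neighbours
  strictly between \<open>x (Suc i)\<close> and the other neighbour.\<close>

lemma consecutive_points_monotone:
  fixes x :: "nat \<Rightarrow> real"
  assumes inj: "inj_on x {1..n}"
    and free: "\<And>i j. i \<in> {1..<n} \<Longrightarrow> j \<in> {1..n} \<Longrightarrow> x j \<notin> open_segment (x i) (x (Suc i))"
  shows "(\<forall>i\<in>{1..<n}. x i < x (Suc i)) \<or> (\<forall>i\<in>{1..<n}. x (Suc i) < x i)"
proof -
  have step: "x i < x (Suc i) \<longleftrightarrow> x (Suc i) < x (Suc (Suc i))" if "1 \<le> i" "Suc (Suc i) \<le> n" for i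
  proof -
    have "x i \<noteq> x (Suc i)" "x (Suc i) \<noteq> x (Suc (Suc i))" "x i \<noteq> x (Suc (Suc i))"
      using that inj by (auto dest!: inj_onD)
    moreover have "x i \<notin> open_segment (x (Suc i)) (x (Suc (Suc i)))"
      "x (Suc (Suc i)) \<notin> open_segment (x i) (x (Suc i))"
      using that free[of "Suc i" i] free[of i "Suc (Suc i)"] by auto
    ultimately show ?thesis by (auto simp: open_segment_eq_real_ivl split: if_splits)
  qed
  have all: "x i < x (Suc i) \<longleftrightarrow> x 1 < x (Suc 1)" if "1 \<le> i" "i < n" for i
    using that by (induction i rule: nat_induct_at_least) (auto simp: step[symmetric])
  have "x i \<noteq> x (Suc i)" if "1 \<le> i" "i < n" for i
    using that inj by (auto dest!: inj_onD)
  with all show ?thesis by (smt (verit) atLeastLessThan_iff linorder_neqE_linordered_idom)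
qed

text \<open>In some order, the squares of the sum and of the difference of the radii are R^2 (2 - l
  - k)^2 and R^2 (l - k)^2. The latter would force l k |pq|^2 = 0; the former gives the claim
  because (2 - l - k)^2 - (l - k)^2 = 4 (1 - l)(1 - k).\<close>

lemma tangency_invariant:
  fixes c p q z :: "'a::real_inner"
  assumes R: "R > 0" and p: "dist c p = R" "dist c q = R" and l: "l \<noteq> 0" "l \<noteq> 1" "k \<noteq> 0" "k \<noteq> 1"
    and tan: "sphere (c + l *\<^sub>R (p - c)) (\<bar>1 - l\<bar> * R) \<inter> sphere (c + k *\<^sub>R (q - c)) (\<bar>1 - k\<bar> * R) = {z}"
    and ne: "p \<noteq> q"
  shows "l / (1 - l) * (k / (1 - k)) * (dist p q)\<^sup>2 = 4 * R\<^sup>2"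
proof -
  define d where "d = (dist p q)\<^sup>2"
  have d: "d \<noteq> 0" using ne by (simp add: d_def)
  have "R\<^sup>2 * (l - k)\<^sup>2 + l * k * d = (\<bar>1 - l\<bar> * R + \<bar>1 - k\<bar> * R)\<^sup>2 \<or>
        R\<^sup>2 * (l - k)\<^sup>2 + l * k * d = (\<bar>1 - l\<bar> * R - \<bar>1 - k\<bar> * R)\<^sup>2"
    using tangent_spheres_dist[OF _ tan] R l unfolding dist_tangent_centers[OF p] d_def by simp
  moreover have "(\<bar>1 - l\<bar> * R + \<bar>1 - k\<bar> * R)\<^sup>2 \<in> {R\<^sup>2 * (2 - l - k)\<^sup>2, R\<^sup>2 * (l - k)\<^sup>2}"
    "(\<bar>1 - l\<bar> * R - \<bar>1 - k\<bar> * R)\<^sup>2 \<in> {R\<^sup>2 * (2 - l - k)\<^sup>2, R\<^sup>2 * (l - k)\<^sup>2}"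
    by (cases "l < 1"; cases "k < 1"; simp add: power2_eq_square algebra_simps)+
  ultimately have "R\<^sup>2 * (l - k)\<^sup>2 + l * k * d = R\<^sup>2 * (2 - l - k)\<^sup>2 \<or> l * k * d = 0" by auto
  then have "l * k * d = R\<^sup>2 * (2 - l - k)\<^sup>2 - R\<^sup>2 * (l - k)\<^sup>2" using d l by auto
  also have "\<dots> = 4 * R\<^sup>2 * ((1 - l) * (1 - k))" by (simp add: power2_eq_square algebra_simps)
  finally have "l * k * d / ((1 - l) * (1 - k)) = 4 * R\<^sup>2"
    using l by (simp add: nonzero_divide_eq_eq)
  then show ?thesis unfolding d_def by simp
qed

text \<open>After subtraction of R^2 (l - k)^2, the squares of the sum and of the difference of the
  radii are 0 and 4 R^2 m, in an order that depends on the sign of \<open>m\<close>. Dividing by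
  \<open>m\<close> gives the same alternative for both signs.\<close>

lemma disjointness_invariant:
  fixes c p q z :: "real^2"
  assumes R: "R > 0" and p: "dist c p = R" "dist c q = R" and l: "l \<noteq> 1" "k \<noteq> 1"
    and dis: "sphere (c + l *\<^sub>R (p - c)) (\<bar>1 - l\<bar> * R) \<inter> sphere (c + k *\<^sub>R (q - c)) (\<bar>1 - k\<bar> * R) = {}"
  defines "Q \<equiv> l / (1 - l) * (k / (1 - k)) * (dist p q)\<^sup>2"
  shows "Q > 4 * R\<^sup>2 \<or> Q < 0"
proof -
  define d where "d = (dist p q)\<^sup>2"
  define m where "m = (1 - l) * (1 - k)"
  have m: "m \<noteq> 0" using l by (simp add: m_def)
  have Q: "l * k * d = Q * m" using l by (simp add: Q_def d_def m_def)
  have "R\<^sup>2 * (l - k)\<^sup>2 + l * k * d > (\<bar>1 - l\<bar> * R + \<bar>1 - k\<bar> * R)\<^sup>2 \<or>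
        R\<^sup>2 * (l - k)\<^sup>2 + l * k * d < (\<bar>1 - l\<bar> * R - \<bar>1 - k\<bar> * R)\<^sup>2"
    using disjoint_spheres_dist[OF _ _ dis] R l unfolding dist_tangent_centers[OF p] d_def by simp
  moreover have "(\<bar>1 - l\<bar> * R + \<bar>1 - k\<bar> * R)\<^sup>2 = R\<^sup>2 * (l - k)\<^sup>2 + 2 * R\<^sup>2 * (\<bar>m\<bar> + m)"
    "(\<bar>1 - l\<bar> * R - \<bar>1 - k\<bar> * R)\<^sup>2 = R\<^sup>2 * (l - k)\<^sup>2 + 2 * R\<^sup>2 * (m - \<bar>m\<bar>)"
    unfolding m_def abs_mult
    by (cases "l < 1"; cases "k < 1"; simp add: power2_eq_square algebra_simps)+
  ultimately have "Q * m > 2 * R\<^sup>2 * (\<bar>m\<bar> + m) \<or> Q * m < 2 * R\<^sup>2 * (m - \<bar>m\<bar>)" using Q by auto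
  then have "(m > 0 \<and> (Q * m > 4 * R\<^sup>2 * m \<or> Q * m < 0)) \<or> (m < 0 \<and> (Q * m > 0 \<or> Q * m < 4 * R\<^sup>2 * m))"
    using m by (cases "m > 0") (auto simp: algebra_simps)
  then show ?thesis by (auto simp: mult_less_0_iff zero_less_mult_iff)
qed

lemma no_eight_tangent_circles:
  fixes K :: "nat \<Rightarrow> (real^2) set" and P :: "nat \<Rightarrow> real^2"
  assumes R: "R > 0" and w: "w \<in> sphere c R"
    and K: "\<And>i. i \<in> {1..8} \<Longrightarrow> is_circle (K i)"
    and P: "\<And>i. i \<in> {1..8} \<Longrightarrow> K i \<inter> sphere c R = {P i} \<and> P i \<noteq> w"
    and tan: "\<And>i j. (i, j) \<in> {(1,4), (5,8), (2,7), (3,6)} \<Longrightarrow> \<exists>z. K i \<inter> K j = {z}"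
    and dis: "\<And>i j. i \<in> {1..8} \<Longrightarrow> j \<in> {1..8} \<Longrightarrow> i < j \<Longrightarrow>
            (i, j) \<notin> {(1,4), (5,8), (2,7), (3,6)} \<Longrightarrow> K i \<inter> K j = {}"
    and inj: "inj_on P {1..8}"
    and consecutive: "\<And>i j. i \<in> {1..<8} \<Longrightarrow> j \<in> {1..8} \<Longrightarrow>
            stereo c w (P j) \<notin> open_segment (stereo c w (P i)) (stereo c w (P (Suc i)))"
  shows False
proof -
  define x where "x i = stereo c w (P i)" for i
  note homeo = homeomorphism_stereo[OF R w]
  have PS: "P i \<in> sphere c R - {w}" "dist c (P i) = R" if "i \<in> {1..8}" for i
    using P[OF that] by auto
  have Px: "P i = stereo_inv c w (x i)" if "i \<in> {1..8}" for i
    using homeomorphism_apply1[OF homeo PS(1)[OF that]] by (simp add: x_def)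
  have injx: "inj_on x {1..8}"
    using inj Px by (metis inj_on_def)
  have "\<exists>l. l \<noteq> 0 \<and> l \<noteq> 1 \<and> K i = sphere (c + l *\<^sub>R (P i - c)) (\<bar>1 - l\<bar> * R)" if "i \<in> {1..8}" for i
  proof -
    obtain a r where Ki: "r > 0" "K i = sphere a r" using K[OF \<open>i \<in> _\<close>] by (auto simp: is_circle_def)
    with P[OF \<open>i \<in> _\<close>] show ?thesis using tangent_circle_center[OF R Ki(1), of a c "P i"] by metis
  qed
  then obtain l where l: "\<And>i. i \<in> {1..8} \<Longrightarrow>
      l i \<noteq> 0 \<and> l i \<noteq> 1 \<and> K i = sphere (c + l i *\<^sub>R (P i - c)) (\<bar>1 - l i\<bar> * R)"
    by metis
  text \<open>\<open>l i / (1 - l i)\<close> is \<open>R\<close> times the difference of the signed curvatures of \<open>K i\<close> and of the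
    common circle; the other factor turns chords into differences of the \<open>x i\<close>.\<close>

  define m where "m i = l i / (1 - l i) / (1/4 + (x i)\<^sup>2)" for i
  have Q: "l i / (1 - l i) * (l j / (1 - l j)) * (dist (P i) (P j))\<^sup>2 = R\<^sup>2 * (m i * m j * (x i - x j)\<^sup>2)"
    if "i \<in> {1..8}" "j \<in> {1..8}" for i j
    unfolding Px[OF that(1)] Px[OF that(2)] m_def
    using dist_stereo_inv[of c w R "x i" "x j"] w by (simp add: mult_ac)
  have tanm: "m i * m j * (x i - x j)\<^sup>2 = 4" if ij: "(i, j) \<in> {(1,4), (5,8), (2,7), (3,6)}" for i j
  proof -
    have ran: "i \<in> {1..8}" "j \<in> {1..8}" "i \<noteq> j" using ij by auto
    obtain z where "K i \<inter> K j = {z}" using tan[OF ij] by blast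
    then have "sphere (c + l i *\<^sub>R (P i - c)) (\<bar>1 - l i\<bar> * R) \<inter>
        sphere (c + l j *\<^sub>R (P j - c)) (\<bar>1 - l j\<bar> * R) = {z}"
      using l ran by metis
    moreover have "P i \<noteq> P j" using inj ran by (auto dest: inj_onD)
    ultimately have "R\<^sup>2 * (m i * m j * (x i - x j)\<^sup>2) = 4 * R\<^sup>2"
      unfolding Q[OF ran(1,2), symmetric] using l[OF ran(1)] l[OF ran(2)] PS(2) ran R
      by (intro tangency_invariant) auto
    then show ?thesis using R by simp
  qed
  have dism: "m i * m j * (x i - x j)\<^sup>2 > 4 \<or> m i * m j * (x i - x j)\<^sup>2 < 0"
    if ran: "i \<in> {1..8}" "j \<in> {1..8}" and ij: "i < j" "(i, j) \<notin> {(1,4), (5,8), (2,7), (3,6)}" for i j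
  proof -
    have "R\<^sup>2 * (m i * m j * (x i - x j)\<^sup>2) > 4 * R\<^sup>2 \<or> R\<^sup>2 * (m i * m j * (x i - x j)\<^sup>2) < 0"
      using disjointness_invariant[OF R PS(2) PS(2), of i j "l i" "l j"] ran l Q dis[OF ran ij]
      by metis
    then show ?thesis using R by (auto simp: mult_less_0_iff)
  qed
  have "(\<forall>i\<in>{1..<8}. x i < x (Suc i)) \<or> (\<forall>i\<in>{1..<8}. x (Suc i) < x i)"
    using consecutive by (intro consecutive_points_monotone injx) (auto simp: x_def)
  then show False
  proof
    assume "\<forall>i\<in>{1..<8}. x i < x (Suc i)"
    then show False using no_eight_points_on_line[of x m] tanm dism by auto
  next
    \<comment> \<open>The projection may reverse the orientation. Reflecting the line repairs this,
      since the conditions contain only squares of differences.\<close>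
    assume "\<forall>i\<in>{1..<8}. x (Suc i) < x i"
    moreover have "(- a - - b)\<^sup>2 = (a - b)\<^sup>2" for a b :: real by (simp add: power2_eq_square algebra_simps)
    ultimately show False using no_eight_points_on_line[of "\<lambda>i. - x i" m] tanm dism by auto
  qed
qed

section \<open>Arcs of a circle\<close>

text \<open>The point with coordinate t has distance R / sqrt(1/4 + t^2) from the center of
  projection, which is less than R / |t|.\<close>

lemma dist_stereo_inv_less:
  assumes R: "R > 0" and w: "w \<in> sphere c R" and e: "e > 0" and t: "\<bar>t\<bar> \<ge> R / e"
  shows "dist (stereo_inv c w t) w < e"
proof -
  have "(w - c) \<bullet> (w - c) = R\<^sup>2" using w by (simp flip: dist_square_inner)
  then have d: "(dist w (stereo_inv c w t))\<^sup>2 = R\<^sup>2 / (1/4 + t\<^sup>2)"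
    by (simp only: dist_square_inner stereo_inv_self_inner)
  have "R \<le> \<bar>t\<bar> * e" using t e by (simp add: field_simps)
  then have "R\<^sup>2 \<le> (\<bar>t\<bar> * e)\<^sup>2" using R by (intro power_mono) auto
  also have "\<dots> < (1/4 + t\<^sup>2) * e\<^sup>2" using e by (simp add: power_mult_distrib)
  finally have "R\<^sup>2 / (1/4 + t\<^sup>2) < e\<^sup>2"
    using stereo_denominator_pos[of t] by (simp add: divide_less_eq mult.commute)
  with d have "(dist w (stereo_inv c w t))\<^sup>2 < e\<^sup>2" by simp
  then show ?thesis using e by (metis dist_commute power2_less_imp_less less_imp_le)
qed

lemma connected_real_mem:
  fixes a b t :: real
  assumes "connected J" "a \<in> J" "b \<in> J" "a \<le> t" "t \<le> b"
  shows "t \<in> J"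
  using assms connected_contains_Icc[of J a b] by auto

text \<open>Seen from \<open>x\<close> by stereographic projection, the components are the bounded intervals
  between the images of the other points of \<open>F\<close>, which stay away from \<open>x\<close>, and two unbounded ones.\<close>

lemma card_components_at_point:
  fixes c :: "real^2"
  assumes R: "R > 0" and x: "x \<in> F" and F: "finite F" "F \<subseteq> sphere c R" "F \<noteq> {x}"
  shows "card {A \<in> components (sphere c R - F). x \<in> closure A} = 2"
proof -
  let ?S = "sphere c R" and ?h = "stereo c x" and ?g = "stereo_inv c x"
  have xS: "x \<in> ?S" using x F by auto
  note homeo = homeomorphism_stereo[OF R xS]
  have hg: "?h (?g t) = t" for t using homeomorphism_apply2[OF homeo] by simp
  have gh: "?g (?h p) = p" if "p \<in> ?S - {x}" for p using homeomorphism_apply1[OF homeo that] .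
  have gS: "?g t \<in> ?S - {x}" for t using homeomorphism_image2[OF homeo] by blast
  have contg: "continuous_on T ?g" for T
    using homeomorphism_cont2[OF homeo] continuous_on_subset by blast
  define F' where "F' = ?h ` (F - {x})"
  have F': "finite F'" "F' \<noteq> {}" using F x by (auto simp: F'_def)
  have gF: "?g t \<in> F \<longleftrightarrow> t \<in> F'" for t
  proof
    assume "?g t \<in> F"
    then have "?g t \<in> F - {x}" using gS[of t] by auto
    then show "t \<in> F'" unfolding F'_def using hg[of t] by (metis image_eqI)
  next
    assume "t \<in> F'"
    then obtain p where "p \<in> F - {x}" "t = ?h p" by (auto simp: F'_def)
    then show "?g t \<in> F" using gh[of p] F by auto
  qed
  define a b where "a = Min F'" and "b = Max F'"
  have ab: "a \<in> F'" "b \<in> F'" "\<And>t. t \<in> F' \<Longrightarrow> a \<le> t \<and> t \<le> b" "a \<le> b"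
    using F' by (auto simp: a_def b_def)
  have h_comp: "connected (?h ` d)" "?h ` d \<inter> F' = {}" "d = ?g ` ?h ` d"
    if "d \<subseteq> ?S - F" "connected d" for d
  proof -
    have sub: "d \<subseteq> ?S - {x}" using that x by auto
    then show "connected (?h ` d)"
      using that homeomorphism_cont1[OF homeo] by (meson connected_continuous_image continuous_on_subset)
    show d: "d = ?g ` ?h ` d" using sub gh by (force simp: image_image)
    show "?h ` d \<inter> F' = {}" using that sub gh gF by force
  qed
  \<comment> \<open>The bounded components need not be enumerated: all of them lie over
    \<open>{a..b}\<close>, and only have to be told apart from the two unbounded ones.\<close>
  have avoid: "J \<subseteq> {..<a} \<or> J \<subseteq> {b<..} \<or> J \<subseteq> {a..b}" if "connected J" "J \<inter> F' = {}" for J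
  proof -
    have "a \<notin> J" "b \<notin> J" using that ab by auto
    then have "(\<forall>t\<in>J. t < a) \<or> (\<forall>t\<in>J. a < t)" "(\<forall>t\<in>J. t < b) \<or> (\<forall>t\<in>J. b < t)"
      using connected_real_mem[OF that(1)] by (metis linorder_neqE_linordered_idom less_imp_le)+
    then show ?thesis using less_imp_le by (auto simp: subset_iff)
  qed
  have comp: "?g ` I \<in> components (?S - F)" if I: "I \<in> {{..<a}, {b<..}}" for I
  proof -
    have disj: "I \<inter> F' = {}" using I ab by force
    have "a - 1 \<in> {..<a}" "b + 1 \<in> {b<..}" by auto
    then have ne: "I \<noteq> {}" using I by blast
    have "d = ?g ` I" if d: "?g ` I \<subseteq> d" "d \<subseteq> ?S - F" "connected d" for d
    proof -
      have "I \<subseteq> ?h ` d" using d(1) hg by (metis image_eqI image_subset_iff subsetI)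
      moreover have "I \<inter> {a..b} = {}" using I ab by auto
      moreover have "{..<a} \<inter> {b<..} = {}" using ab(4) by auto
      ultimately have "?h ` d \<subseteq> I"
        using avoid[OF h_comp(1,2)[OF d(2,3)]] I ne by blast
      then show ?thesis using h_comp(3)[OF d(2,3)] d(1) by blast
    qed
    moreover have "connected (?g ` I)"
      using I contg by (intro connected_continuous_image) auto
    moreover have "?g ` I \<noteq> {}" using ne by auto
    moreover have "?g ` I \<subseteq> ?S - F" using gS gF disj by auto
    ultimately show ?thesis unfolding in_components_maximal by blast
  qed
  have clos: "x \<in> closure (?g ` I)" if I: "I \<in> {{..<a}, {b<..}}" for I
    unfolding closure_approachable
  proof (intro allI impI)
    fix e :: real assume e: "e > 0"
    have "R / e > 0" using R e by simp
    have "\<exists>t\<in>I. \<bar>t\<bar> \<ge> R / e"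
    proof (cases "I = {..<a}")
      case True
      then have "min (a - 1) (- (R / e)) \<in> I" by (simp add: min_less_iff_disj)
      moreover have "\<bar>min (a - 1) (- (R / e))\<bar> \<ge> R / e" using \<open>R / e > 0\<close> by linarith
      ultimately show ?thesis by blast
    next
      case False
      then have "I = {b<..}" using I by blast
      then have "max (b + 1) (R / e) \<in> I" by (simp add: less_max_iff_disj)
      moreover have "\<bar>max (b + 1) (R / e)\<bar> \<ge> R / e" using \<open>R / e > 0\<close> by linarith
      ultimately show ?thesis by blast
    qed
    then show "\<exists>y\<in>?g ` I. dist y x < e" using dist_stereo_inv_less[OF R xS e] by blast
  qed
  have "{A \<in> components (?S - F). x \<in> closure A} = {?g ` {..<a}, ?g ` {b<..}}"
  proof (intro equalityI subsetI)
    fix A assume "A \<in> {A \<in> components (?S - F). x \<in> closure A}"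
    then have A: "A \<in> components (?S - F)" and xA: "x \<in> closure A" by auto
    have A': "A \<subseteq> ?S - F" "connected A" using A in_components_subset in_components_connected by auto
    note h = h_comp[OF A']
    have max: "A = ?g ` I" if "?h ` A \<subseteq> I" "I \<in> {{..<a}, {b<..}}" for I
    proof -
      have sub: "A \<subseteq> ?g ` I" using h(3) that(1) by blast
      have "connected (?g ` I)" "?g ` I \<subseteq> ?S - F"
        using comp[OF that(2)] in_components_connected in_components_subset by blast+
      moreover have "A \<inter> ?g ` I \<noteq> {}" using sub in_components_nonempty[OF A] by blast
      ultimately have "?g ` I \<subseteq> A" using components_maximal[OF A] by blast
      then show ?thesis using sub by blast
    qed
    \<comment> \<open>The image of \<open>{a..b}\<close> is compact and misses \<open>x\<close>, so
      a component contained in it cannot accumulate at \<open>x\<close>.\<close>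
    have "\<not> ?h ` A \<subseteq> {a..b}"
    proof
      assume "?h ` A \<subseteq> {a..b}"
      then have "A \<subseteq> ?g ` {a..b}" using h(3) by blast
      moreover have "closed (?g ` {a..b})"
        using contg by (intro compact_imp_closed compact_continuous_image) auto
      ultimately have "x \<in> ?g ` {a..b}" using xA closure_minimal by blast
      then show False using gS by (metis Diff_iff imageE singletonI)
    qed
    then have "A = ?g ` {..<a} \<or> A = ?g ` {b<..}"
      using avoid[OF h(1,2)] max[of "{..<a}"] max[of "{b<..}"] by (meson insertCI)
    then show "A \<in> {?g ` {..<a}, ?g ` {b<..}}" by (simp only: insert_iff empty_iff simp_thms)
  qed (use comp clos in blast)
  moreover have "?g ` {..<a} \<noteq> ?g ` {b<..}"
  proof
    assume "?g ` {..<a} = ?g ` {b<..}"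
    then have "?h ` ?g ` {..<a} = ?h ` ?g ` {b<..}" by simp
    then have "{..<a} = {b<..}" by (simp add: image_image hg)
    moreover have "a - 1 \<in> {..<a}" "a - 1 \<notin> {b<..}" using ab(4) by auto
    ultimately show False by blast
  qed
  ultimately show ?thesis by simp
qed

text \<open>The punctured circle is connected, so it is its own only component. This is the case of
  a circle with one double point, whose single arc would represent a loop.\<close>

lemma component_of_once_punctured_circle:
  fixes c :: "real^2"
  assumes R: "R > 0" and x: "x \<in> sphere c R" and A: "A \<in> components (sphere c R - {x})"
  shows "closure A - A \<subseteq> {x}"
proof -
  have "connected (sphere c R - {x})"
    using homeomorphism_stereo[OF R x] connected_UNIV homeomorphic_connectedness homeomorphic_def by metis
  then have "A = sphere c R - {x}"
    using A by (metis components_empty components_eq_sing_iff empty_iff singletonD)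
  moreover have "closure (sphere c R - {x}) \<subseteq> sphere c R"
    by (rule closure_minimal) auto
  ultimately show ?thesis by auto
qed

text \<open>In the coordinate an arc is an interval, and an interval contains the open segment
  between any two points of its closure. Thus no double point can be projected between the ends of
  an arc that stays away from \<open>w\<close>.\<close>

lemma stereo_open_segment_in_image:
  assumes R: "R > 0" and w: "w \<in> sphere c R" and A: "connected A" "closure A \<subseteq> sphere c R - {w}"
    and pq: "p \<in> closure A" "q \<in> closure A"
  shows "open_segment (stereo c w p) (stereo c w q) \<subseteq> stereo c w ` A"
proof -
  let ?h = "stereo c w"
  note cont = homeomorphism_cont1[OF homeomorphism_stereo[OF R w]]
  have contA: "continuous_on (closure A) ?h" using A cont continuous_on_subset by blast
  have "connected (?h ` A)"
    using A contA by (meson closure_subset connected_continuous_image continuous_on_subset)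
  then have conv: "convex (?h ` A)" using connected_convex_1 by blast
  have "?h ` closure A \<subseteq> closure (?h ` A)"
    using contA by (intro image_closure_subset) (auto simp: closure_subset)
  then have "closed_segment (?h p) (?h q) \<subseteq> closure (?h ` A)"
    using pq conv by (intro closed_segment_subset convex_closure) auto
  then have "interior (closed_segment (?h p) (?h q)) \<subseteq> interior (closure (?h ` A))"
    by (rule interior_mono)
  also have "\<dots> = interior (?h ` A)" by (rule convex_interior_closure[OF conv])
  finally have "interior (closed_segment (?h p) (?h q)) \<subseteq> ?h ` A" using interior_subset by blast
  moreover have "open_segment (?h p) (?h q) \<subseteq> interior (closed_segment (?h p) (?h q))"
    by (auto simp: closed_segment_eq_real_ivl open_segment_eq_real_ivl split: if_splits)
  ultimately show ?thesis by blast
qed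

section \<open>Circle representations of simple graphs\<close>

text \<open>The right-hand side has multiplicities one, so equal supports and equal sizes force
  injectivity. For simple graphs this turns the multiset condition on arcs into a bijection.\<close>

lemma bij_betw_if_image_mset_set:
  assumes "image_mset f (mset_set A) = mset_set B" "finite A" "finite B"
  shows "bij_betw f A B"
proof -
  have "f ` A = B"
    using arg_cong[OF assms(1), of set_mset] assms(2,3) by simp
  moreover have "card A = card B"
    using arg_cong[OF assms(1), of size] by simp
  ultimately show ?thesis
    using assms(2) by (simp add: bij_betw_def eq_card_imp_inj_on)
qed

lemma simple_graph_edges_mset_set:
  assumes "simple_graph G"
  shows "edges G = mset_set (set_mset (edges G))"
  using assms by (intro multiset_eqI) (auto simp: simple_graph_def count_mset_set' not_in_iff)

locale circle_rep =
  fixes G :: "'v multigraph" and \<C> :: "(real^2) set set" and p :: "'v \<Rightarrow> real^2"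
  assumes rep: "circle_representation G \<C> p" and simple: "simple_graph G"
begin

abbreviation "V \<equiv> verts G"
abbreviation "E \<equiv> set_mset (edges G)"
abbreviation "D \<equiv> double_points \<C>"

lemma finite_V: "finite V" and edge_subset: "e \<in> E \<Longrightarrow> e \<subseteq> V" and card_edge: "e \<in> E \<Longrightarrow> card e = 2"
  using simple by (auto simp: simple_graph_def)

lemma inj_p: "inj_on p V" and D_eq: "D = p ` V"
  using rep by (auto simp: circle_representation_def bij_betw_def)

lemma finite_D: "finite D"
  by (simp add: D_eq finite_V)

lemma circle: "C \<in> \<C> \<Longrightarrow> is_circle C"
  using rep by (simp add: circle_representation_def)

lemma circles_through_finite: "finite (circles_through \<C> x)" "card (circles_through \<C> x) \<le> 2"
  using rep by (simp_all add: circle_representation_def)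

lemma common_point_double:
  assumes "C \<in> \<C>" "C' \<in> \<C>" "C \<noteq> C'" "x \<in> C" "x \<in> C'"
  shows "x \<in> D"
proof -
  have "card {C, C'} \<le> card (circles_through \<C> x)"
    using assms circles_through_finite(1) by (intro card_mono) (auto simp: circles_through_def)
  then show ?thesis using assms circles_through_finite(2)[of x] by (simp add: double_points_def)
qed

lemma card_common_le_2:
  assumes "C \<in> \<C>" "C' \<in> \<C>" "C \<noteq> C'" "{x, y, z} \<subseteq> C \<inter> C'" "x \<noteq> y" "y \<noteq> z" "x \<noteq> z"
  shows False
  using assms circle three_common_points_same_circle unfolding is_circle_def by metis

lemma arcs_bij: "bij_betw arc_ends (arcs \<C>) ((`) p ` E)" and arcs_finite: "finite (arcs \<C>)"
proof -
  show fin: "finite (arcs \<C>)" using rep by (simp add: circle_representation_def)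
  have "inj_on ((`) p) E"
    using inj_p edge_subset by (meson inj_on_def inj_on_image_eq_iff)
  then have "image_mset ((`) p) (edges G) = mset_set ((`) p ` E)"
    by (subst simple_graph_edges_mset_set[OF simple]) (simp add: image_mset_mset_set)
  then show "bij_betw arc_ends (arcs \<C>) ((`) p ` E)"
    using rep fin by (intro bij_betw_if_image_mset_set) (auto simp: circle_representation_def)
qed

lemma arcs_component:
  assumes "A \<in> arcs \<C>"
  obtains C where "C \<in> \<C>" "A \<in> components (C - D)"
  using assms by (auto simp: arcs_def)

lemma component_arc: "C \<in> \<C> \<Longrightarrow> C \<inter> D \<noteq> {} \<Longrightarrow> A \<in> components (C - D) \<Longrightarrow> A \<in> arcs \<C>"
  by (auto simp: arcs_def)

text \<open>In a simple graph an edge is determined by its ends, so the arc can be recovered by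
  inverting \<open>arc_ends\<close>.\<close>

definition arc :: "'v set \<Rightarrow> (real^2) set" where
  "arc e = inv_into (arcs \<C>) arc_ends (p ` e)"

text \<open>The choice is unique: two circles meet only in double points, and arcs contain none (see
  \<open>circ_eqI\<close>).\<close>

definition circ :: "'v set \<Rightarrow> (real^2) set" where
  "circ e = (SOME C. C \<in> \<C> \<and> arc e \<in> components (C - D))"

lemma arc_in: "e \<in> E \<Longrightarrow> arc e \<in> arcs \<C>" and arc_ends_arc: "e \<in> E \<Longrightarrow> arc_ends (arc e) = p ` e"
  unfolding arc_def using arcs_bij
  by (metis bij_betw_def image_eqI inv_into_into, metis bij_betw_inv_into_right image_eqI)

lemma arcs_obtain:
  assumes "A \<in> arcs \<C>"
  obtains e where "e \<in> E" "A = arc e"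
proof -
  have "arc_ends A \<in> (`) p ` E" using assms arcs_bij by (auto simp: bij_betw_def)
  then obtain e where "e \<in> E" "arc_ends A = p ` e" by auto
  then show ?thesis using assms arcs_bij that by (metis arc_def bij_betw_inv_into_left)
qed

lemma inj_arc: "inj_on arc E"
  using arc_ends_arc inj_p edge_subset by (metis inj_on_image_eq_iff inj_onI)

lemma circ: "e \<in> E \<Longrightarrow> circ e \<in> \<C> \<and> arc e \<in> components (circ e - D)"
  unfolding circ_def using arcs_component[OF arc_in] by (rule someI2_ex) blast+

lemma arc_props:
  assumes "e \<in> E"
  shows "arc e \<noteq> {}" "arc e \<subseteq> circ e" "arc e \<inter> D = {}" "connected (arc e)"
    "closure (arc e) = arc e \<union> p ` e" "closure (arc e) \<subseteq> circ e"
proof -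
  note c = circ[OF assms]
  show "arc e \<noteq> {}" "arc e \<subseteq> circ e" "arc e \<inter> D = {}" "connected (arc e)"
    using c in_components_nonempty in_components_subset in_components_connected by blast+
  show "closure (arc e) = arc e \<union> p ` e"
    using arc_ends_arc[OF assms] closure_subset[of "arc e"] by (auto simp: arc_ends_def)
  have "closed (circ e)" using circle[of "circ e"] c by (auto simp: is_circle_def)
  then show "closure (arc e) \<subseteq> circ e"
    using \<open>arc e \<subseteq> circ e\<close> by (rule closure_minimal[rotated])
qed

lemma circ_eqI:
  assumes "e \<in> E" "C \<in> \<C>" "x \<in> arc e" "x \<in> C"
  shows "circ e = C"
  using assms arc_props[OF assms(1)] circ[OF assms(1)] common_point_double[of "circ e" C x] by auto

lemma p_in_circ: "e \<in> E \<Longrightarrow> v \<in> e \<Longrightarrow> p v \<in> circ e"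
  using arc_props(5,6) by blast

lemma p_in_closure_arc_iff:
  assumes "e \<in> E" "v \<in> V"
  shows "p v \<in> closure (arc e) \<longleftrightarrow> v \<in> e"
proof -
  have "p v \<notin> arc e" using assms arc_props(3)[OF assms(1)] D_eq by auto
  then show ?thesis
    using arc_props(5)[OF assms(1)] assms inj_p edge_subset[OF assms(1)] by (auto dest: inj_onD)
qed

lemma components_eq_arcs:
  assumes "C \<in> \<C>" "C \<inter> D \<noteq> {}"
  shows "components (C - D) = arc ` {e \<in> E. circ e = C}"
proof (intro equalityI subsetI)
  fix A assume A: "A \<in> components (C - D)"
  then obtain e where e: "e \<in> E" "A = arc e"
    using arcs_obtain[OF component_arc[OF assms A]] by blast
  moreover have "A \<noteq> {}" "A \<subseteq> C" using A in_components_nonempty in_components_subset by blast+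
  ultimately have "circ e = C" using circ_eqI assms by blast
  with e show "A \<in> arc ` {e \<in> E. circ e = C}" by blast
qed (use circ in auto)

text \<open>This is \<open>card_components_at_point\<close> read in the graph. It requires a second
  double point on the circle; if \<open>p v\<close> were the only one, some arc would have at most
  one end, while edges have two.\<close>

lemma card_incident_circ:
  assumes "v \<in> V" "C \<in> \<C>" "p v \<in> C"
  shows "card {e \<in> E. v \<in> e \<and> circ e = C} = 2"
proof -
  obtain c R where cR: "R > 0" "C = sphere c R" using circle[OF assms(2)] by (auto simp: is_circle_def)
  have pD: "p v \<in> D" using assms D_eq by auto
  have ne: "C \<inter> D \<noteq> {}" using assms pD by auto
  have CD: "C - C \<inter> D = C - D" by auto
  note comp = components_eq_arcs[OF assms(2) ne]
  have "C \<inter> D \<noteq> {p v}"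
  proof
    assume eq: "C \<inter> D = {p v}"
    have "C - {p v} \<noteq> {}" using sphere_not_singleton[OF cR(1), of c "p v"] cR(2) assms(3) by auto
    then obtain A where A: "A \<in> components (C - {p v})" by (meson components_eq_empty ex_in_conv)
    then have "closure A - A \<subseteq> {p v}"
      using component_of_once_punctured_circle[OF cR(1)] cR(2) assms(3) by metis
    moreover obtain e where e: "e \<in> E" "A = arc e" using comp A CD eq by auto
    ultimately have "p ` e \<subseteq> {p v}" using arc_ends_arc by (simp add: arc_ends_def)
    then have "card (p ` e) \<le> 1" using card_mono[of "{p v}" "p ` e"] by simp
    moreover have "card (p ` e) = 2"
      using card_image inj_p edge_subset[OF e(1)] card_edge[OF e(1)] by (metis inj_on_subset)
    ultimately show False by simp
  qed
  then have "card {A \<in> components (C - C \<inter> D). p v \<in> closure A} = 2"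
    unfolding cR(2) using assms pD finite_D cR by (intro card_components_at_point) auto
  also have "{A \<in> components (C - C \<inter> D). p v \<in> closure A} = arc ` {e \<in> E. v \<in> e \<and> circ e = C}"
    unfolding CD comp using p_in_closure_arc_iff assms by blast
  also have "card \<dots> = card {e \<in> E. v \<in> e \<and> circ e = C}"
    by (intro card_image inj_on_subset[OF inj_arc]) auto
  finally show ?thesis .
qed

text \<open>Otherwise the closed arcs with ends in \<open>S\<close> and those with ends outside
  \<open>S\<close> would split the connected circle into two disjoint nonempty closed sets. This
  confines the vertices on a circle by a purely combinatorial check.\<close>

lemma circle_vertices_subset:
  assumes C: "C \<in> \<C>" and s: "s \<in> S" "s \<in> V" "p s \<in> C"
    and closed: "\<And>e. e \<in> E \<Longrightarrow> circ e = C \<Longrightarrow> e \<inter> S \<noteq> {} \<Longrightarrow> e \<subseteq> S"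
    and v: "v \<in> V" "p v \<in> C"
  shows "v \<in> S"
proof (rule ccontr)
  assume "v \<notin> S"
  define X where "X = \<Union> ((closure \<circ> arc) ` {e \<in> E. circ e = C \<and> e \<subseteq> S})"
  define Y where "Y = \<Union> ((closure \<circ> arc) ` {e \<in> E. circ e = C \<and> e \<inter> S = {}})"
  have edge_at: "\<exists>e\<in>E. circ e = C \<and> u \<in> e" if "u \<in> V" "p u \<in> C" for u
  proof -
    have "{e \<in> E. u \<in> e \<and> circ e = C} \<noteq> {}"
      using card_incident_circ[OF that(1) C that(2)] by (metis card.empty zero_neq_numeral)
    then show ?thesis by blast
  qed
  have ne: "C \<inter> D \<noteq> {}" using s D_eq by auto
  \<comment> \<open>Every point of the circle lies on a closed arc: a double point is an end of one
    by \<open>card_incident_circ\<close>, any other point lies in a component.\<close>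
  have mem: "q \<in> X \<union> Y" if q: "q \<in> C" for q
  proof -
    have "\<exists>e\<in>E. circ e = C \<and> q \<in> closure (arc e)"
    proof (cases "q \<in> D")
      case True
      then obtain u where u: "u \<in> V" "q = p u" using D_eq by auto
      with q edge_at obtain e where "e \<in> E" "circ e = C" "u \<in> e" by blast
      with u show ?thesis using p_in_closure_arc_iff by blast
    next
      case False
      with q have "q \<in> \<Union> (components (C - D))" by (metis DiffI Union_components)
      then obtain A where "A \<in> components (C - D)" "q \<in> A" by blast
      then obtain e where "e \<in> E" "circ e = C" "q \<in> arc e"
        unfolding components_eq_arcs[OF C ne] by blast
      then show ?thesis using closure_subset by blast
    qed
    then obtain e where e: "e \<in> E" "circ e = C" "q \<in> closure (arc e)" by blast
    then have "e \<subseteq> S \<or> e \<inter> S = {}" using closed by blast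
    with e show ?thesis unfolding X_def Y_def by auto
  qed
  have "X \<union> Y \<subseteq> C" using arc_props(6) unfolding X_def Y_def by auto
  with mem have XY: "X \<union> Y = C" by auto
  have "X \<inter> Y = {}"
  proof -
    have "closure (arc e) \<inter> closure (arc f) = {}"
      if e: "e \<in> E" "circ e = C" "e \<subseteq> S" and f: "f \<in> E" "circ f = C" "f \<inter> S = {}" for e f
    proof -
      have "e \<noteq> {}" using card_edge[OF e(1)] by auto
      then have "e \<noteq> f" using e(3) f(3) by blast
      then have "arc e \<noteq> arc f" using inj_arc e(1) f(1) by (auto dest: inj_onD)
      then have "arc e \<inter> arc f = {}"
        using circ[OF e(1)] circ[OF f(1)] e(2) f(2) by (metis components_nonoverlap)
      moreover have "p ` e \<inter> p ` f = p ` (e \<inter> f)"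
        using inj_on_image_Int[OF inj_p] edge_subset[OF e(1)] edge_subset[OF f(1)] by metis
      then have "p ` e \<inter> p ` f = {}" using e(3) f(3) by auto
      moreover have "p ` e \<subseteq> D" "p ` f \<subseteq> D"
        unfolding D_eq using edge_subset[OF e(1)] edge_subset[OF f(1)] by (simp_all add: image_mono)
      ultimately show ?thesis
        unfolding arc_props(5)[OF e(1)] arc_props(5)[OF f(1)]
        using arc_props(3)[OF e(1)] arc_props(3)[OF f(1)] by blast
    qed
    then show ?thesis unfolding X_def Y_def by fastforce
  qed
  moreover have "closed X" "closed Y" unfolding X_def Y_def by (auto intro!: closed_UN)
  moreover have "connected C"
    using circle[OF C] by (auto simp: is_circle_def intro: connected_sphere)
  moreover have "X \<noteq> {}"
  proof -
    obtain e where e: "e \<in> E" "circ e = C" "s \<in> e" using edge_at[OF s(2,3)] by blast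
    then have "e \<subseteq> S" using closed s(1) by blast
    with e show ?thesis using arc_props(1,5) unfolding X_def by force
  qed
  moreover have "Y \<noteq> {}"
  proof -
    obtain e where e: "e \<in> E" "circ e = C" "v \<in> e" using edge_at[OF v] by blast
    then have "e \<inter> S = {}" using closed \<open>v \<notin> S\<close> by blast
    with e show ?thesis using arc_props(1,5) unfolding Y_def by force
  qed
  ultimately show False
    using XY unfolding connected_closed by blast
qed

lemma even_incident_circ:
  assumes "C \<in> \<C>" "v \<in> V"
  shows "even (card {e \<in> E. circ e = C \<and> v \<in> e})"
proof (cases "p v \<in> C")
  case True
  then show ?thesis using card_incident_circ[OF assms(2,1)] by (simp add: conj_commute)
next
  case False
  then have "{e \<in> E. circ e = C \<and> v \<in> e} = {}" using p_in_circ by auto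
  then show ?thesis by (metis card.empty even_zero)
qed

text \<open>Handshake argument: the edges on \<open>C\<close> have degree 0 or 2 at every vertex of
  \<open>S\<close>. Summed over \<open>S\<close>, an edge is counted once for each of its ends in
  \<open>S\<close>, so the odd contributions are those of the cut edges.\<close>

lemma even_card_circ_cut:
  assumes C: "C \<in> \<C>" and S: "S \<subseteq> V"
  shows "even (card {e \<in> E. circ e = C \<and> card (e \<inter> S) = 1})"
proof -
  let ?EC = "{e \<in> E. circ e = C}"
  have fin: "finite ?EC" "finite S" using finite_subset[OF S finite_V] by auto
  have inc: "(\<Sum>e\<in>?EC. of_bool (v \<in> e)) = card {e \<in> E. circ e = C \<and> v \<in> e}" for v
  proof -
    have "?EC \<inter> {e. v \<in> e} = {e \<in> E. circ e = C \<and> v \<in> e}" by auto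
    then show ?thesis using fin(1) by (simp only: sum_of_bool_eq of_nat_id)
  qed
  have int: "(\<Sum>v\<in>S. of_bool (v \<in> e)) = card (e \<inter> S)" for e
    using fin(2) by (simp only: sum_of_bool_eq of_nat_id Collect_mem_eq Int_commute)
  have "(\<Sum>e\<in>?EC. card (e \<inter> S)) = (\<Sum>v\<in>S. card {e \<in> E. circ e = C \<and> v \<in> e})"
    unfolding inc[symmetric] int[symmetric] by (rule sum.swap)
  also have "even \<dots>" using even_incident_circ[OF C] S by (intro dvd_sum) auto
  finally have "even (card {e \<in> ?EC. odd (card (e \<inter> S))})"
    using fin by (simp add: even_sum_iff)
  also have "{e \<in> ?EC. odd (card (e \<inter> S))} = {e \<in> E. circ e = C \<and> card (e \<inter> S) = 1}"
  proof -
    have "odd (card (e \<inter> S)) \<longleftrightarrow> card (e \<inter> S) = 1" if "e \<in> E" for e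
    proof -
      have "finite e" using card_edge[OF that] card.infinite by fastforce
      then have "card (e \<inter> S) \<le> 2" using card_mono[of e "e \<inter> S"] card_edge[OF that] by simp
      then have "card (e \<inter> S) \<in> {0, 1, 2}" by auto
      then show ?thesis by auto
    qed
    then show ?thesis by auto
  qed
  finally show ?thesis .
qed

text \<open>Otherwise the circle of \<open>e\<close> would meet the cut exactly once, against
  parity.\<close>

lemma two_edge_cut_same_circle:
  assumes "S \<subseteq> V" and cut: "{e \<in> E. card (e \<inter> S) = 1} = {e, f}" and "e \<noteq> f"
  shows "circ e = circ f"
proof (rule ccontr)
  assume ne: "circ e \<noteq> circ f"
  have "e \<in> E" using cut by blast
  then have "even (card {g \<in> E. circ g = circ e \<and> card (g \<inter> S) = 1})"
    using even_card_circ_cut assms(1) circ by blast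
  also have "{g \<in> E. circ g = circ e \<and> card (g \<inter> S) = 1} = {e}" using cut ne by blast
  finally show False by simp
qed

text \<open>This rephrases \<open>card_incident_circ\<close> as an equation between 0-1 terms, so
  that knowing some of the circles at a 4-valent vertex lets arithmetic determine the
  others.\<close>

lemma four_edges_at:
  assumes v: "v \<in> V" "{e \<in> E. v \<in> e} = {e1, e2, e3, e4}" and dist: "distinct [e1, e2, e3, e4]"
    and C: "C \<in> \<C>" "p v \<in> C"
  shows "of_bool (circ e1 = C) + of_bool (circ e2 = C) + of_bool (circ e3 = C) + of_bool (circ e4 = C) = (2::nat)"
proof -
  have "{e \<in> E. v \<in> e \<and> circ e = C} = {e \<in> {e1, e2, e3, e4}. circ e = C}"
    unfolding v(2)[symmetric] by blast
  also have "\<dots> = {e1, e2, e3, e4} \<inter> {e. circ e = C}" by blast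
  finally have "card ({e1, e2, e3, e4} \<inter> {e. circ e = C}) = 2"
    using card_incident_circ[OF v(1) C] by simp
  moreover have "finite {e1, e2, e3, e4}" by simp
  ultimately have "(\<Sum>e\<in>{e1, e2, e3, e4}. of_bool (circ e = C)) = (2::nat)"
    by (simp only: sum_of_bool_eq) simp
  then show ?thesis using dist by (simp add: add.assoc del: sum_of_bool_eq)
qed

end

section \<open>Digons replaced by gadgets with a two-edge cut\<close>

text \<open>The indices run from 1 to 8. Entry 0 of \<open>rim\<close> repeats \<open>V8\<close>, so that the cycle edges join
  \<open>rim (i - 1)\<close> and \<open>rim i\<close>; in \<open>apex\<close> and \<open>partner\<close> it is a dummy.\<close>

definition rim :: "nat \<Rightarrow> mvertex" where
  "rim i = [V8, V1, V2, V3, V4, V5, V6, V7, V8] ! i"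

definition apex :: "nat \<Rightarrow> mvertex" where
  "apex i = [Vd, Va, Vb, Vc, Va, Vd, Vc, Vb, Vd] ! i"

definition partner :: "nat \<Rightarrow> nat" where
  "partner i = [0, 4, 7, 6, 1, 8, 3, 2, 5] ! i"

definition digon :: "nat \<Rightarrow> mvertex \<times> mvertex" where
  "digon i = (apex i, rim i)"

section \<open>Index tables for the 8-cycle and the digons\<close>

lemma indices: "{1..8::nat} = {1, 2, 3, 4, 5, 6, 7, 8}"
  by auto

lemma rim_simps [simp]:
  "rim 0 = V8" "rim (Suc 0) = V1" "rim 1 = V1" "rim 2 = V2" "rim 3 = V3" "rim 4 = V4" "rim 5 = V5" "rim 6 = V6" "rim 7 = V7" "rim 8 = V8"
  by (simp_all add: rim_def)

lemma apex_simps [simp]: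
  "apex (Suc 0) = Va" "apex 1 = Va" "apex 2 = Vb" "apex 3 = Vc" "apex 4 = Va" "apex 5 = Vd" "apex 6 = Vc" "apex 7 = Vb" "apex 8 = Vd"
  by (simp_all add: apex_def)

lemma partner_simps [simp]:
  "partner (Suc 0) = 4" "partner 1 = 4" "partner 2 = 7" "partner 3 = 6" "partner 4 = 1" "partner 5 = 8" "partner 6 = 3" "partner 7 = 2" "partner 8 = 5"
  by (simp_all add: partner_def)

lemma rim_inject [rule_format]: "\<forall>i\<in>{1..8}. \<forall>j\<in>{1..8}. rim i = rim j \<longleftrightarrow> i = j"
  unfolding indices by simp

lemma apex_rim_ne [rule_format]: "\<forall>i\<in>{1..8}. \<forall>j\<in>{1..8}. apex i \<noteq> rim j"
  unfolding indices by simp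

lemma apex_rim_pred_ne [rule_format]: "\<forall>i\<in>{1..8}. \<forall>j\<in>{1..8}. apex i \<noteq> rim (j - 1)"
  unfolding indices by simp

lemma partner [rule_format]: "\<forall>i\<in>{1..8}. partner i \<in> {1..8} \<and> partner i \<noteq> i \<and> partner (partner i) = i"
  unfolding indices by simp

lemma apex_eq_apex_iff [rule_format]: "\<forall>i\<in>{1..8}. \<forall>k\<in>{1..8}. apex k = apex i \<longleftrightarrow> k = i \<or> k = partner i"
  unfolding indices by simp

lemma apex_eq_iff [rule_format]: "\<forall>i\<in>{1..8}. \<forall>j\<in>{1..8}. i < j \<longrightarrow> apex i = apex j \<longleftrightarrow> (i, j) \<in> {(1,4), (5,8), (2,7), (3,6)}"
  unfolding indices by simp

lemma set_digons: "set digons = digon ` {1..8}"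
  unfolding indices by (auto simp: digons_def digon_def)

lemma base_M_minus_digon_edges:
  "edges base_M - digon_edges =
     {# {V1, V2}, {V2, V3}, {V3, V4}, {V4, V5}, {V5, V6}, {V6, V7}, {V7, V8}, {V8, V1} #} + digon_edges"
proof -
  have "repeat_mset 2 digon_edges = digon_edges + digon_edges"
    by (simp add: numeral_2_eq_2)
  then show ?thesis by (simp add: base_M_def)
qed

lemma set_base_M_minus_digon_edges:
  "set_mset (edges base_M - digon_edges) =
     (\<lambda>i. {rim (i - 1), rim i}) ` {1..8} \<union> (\<lambda>i. {apex i, rim i}) ` {1..8}"
  unfolding base_M_minus_digon_edges indices
  by (simp add: digon_edges_def digons_def)
    (intro equalityI subsetI; elim insertE emptyE; simp)

lemma set_mset_sum_list_map: "set_mset (\<Sum>x\<leftarrow>xs. f x) = (\<Union>x\<in>set xs. set_mset (f x))"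
  by (induction xs) auto

text \<open>The common shape of both constructions: \<open>gi\<close> is attached to the apex and
  \<open>gj\<close> to the rim vertex, with arbitrary inner edges \<open>K\<close>. The two may
  coincide, as in the octahedral gadget, where both are \<open>Ou\<close>.\<close>

locale two_edge_gadget =
  fixes gad :: "'g hvertex \<Rightarrow> 'g hvertex \<Rightarrow> ('g \<Rightarrow> 'g hvertex) \<Rightarrow> 'g hvertex set multiset"
    and gi gj :: 'g and K :: "'g set multiset"
  assumes gad: "\<And>x y n. gad x y n = {# {x, n gi}, {n gj, y} #} + image_mset ((`) n) K"
begin

abbreviation "H \<equiv> replace_digons gad"

abbreviation "B v \<equiv> Base v :: 'g hvertex"

definition "rim_edge i = {B (rim (i - 1)), B (rim i)}"
definition "direct_edge i = {B (apex i), B (rim i)}"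
definition "apex_cut i = {B (apex i), New (digon i) gi}"
definition "rim_cut i = {New (digon i) gj, B (rim i)}"

lemmas edge_defs = rim_edge_def direct_edge_def apex_cut_def rim_cut_def

lemma set_edges_H:
  "set_mset (edges H) =
     rim_edge ` {1..8} \<union> direct_edge ` {1..8} \<union> apex_cut ` {1..8} \<union> rim_cut ` {1..8}
     \<union> (\<Union>i\<in>{1..8}. (`) (New (digon i)) ` set_mset K)" (is "?l = ?r")
proof -
  have "?l = (`) Base ` ((\<lambda>i. {rim (i - 1), rim i}) ` {1..8} \<union> (\<lambda>i. {apex i, rim i}) ` {1..8})
     \<union> (\<Union>i\<in>{1..8}. set_mset (gad (B (apex i)) (B (rim i)) (New (digon i))))"
    unfolding replace_digons_def multigraph.simps set_mset_union set_image_mset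
      set_base_M_minus_digon_edges set_mset_sum_list_map set_digons
    by (simp only: image_image digon_def prod.case)
  also have "\<dots> = ?r" unfolding gad edge_defs by (simp add: image_Un image_image) blast
  finally show ?thesis .
qed

lemma verts_H: "verts H = range Base \<union> {New (digon i) g | i g. i \<in> {1..8}}"
  unfolding replace_digons_def multigraph.simps set_digons by (simp only: base_M_def multigraph.simps) blast

lemma H_edge_cases:
  assumes "e \<in> set_mset (edges H)"
  obtains (rim_edge) k where "k \<in> {1..8}" "e = rim_edge k"
    | (direct_edge) k where "k \<in> {1..8}" "e = direct_edge k"
    | (apex_cut) k where "k \<in> {1..8}" "e = apex_cut k"
    | (rim_cut) k where "k \<in> {1..8}" "e = rim_cut k"
    | (inner) k A where "k \<in> {1..8}" "e = New (digon k) ` A" "A \<in># K"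
  using assms unfolding set_edges_H by blast

lemma H_edges:
  assumes "i \<in> {1..8}"
  shows "rim_edge i \<in># edges H" "direct_edge i \<in># edges H" "apex_cut i \<in># edges H" "rim_cut i \<in># edges H"
  using assms unfolding set_edges_H by blast+

lemma edges_at_apex:
  assumes i: "i \<in> {1..8}"
  shows "{e \<in> set_mset (edges H). B (apex i) \<in> e} =
    {direct_edge i, apex_cut i, direct_edge (partner i), apex_cut (partner i)}"
proof (intro equalityI subsetI)
  fix e assume "e \<in> {e \<in> set_mset (edges H). B (apex i) \<in> e}"
  then have e: "e \<in># edges H" "B (apex i) \<in> e" by auto
  from e(1) show "e \<in> {direct_edge i, apex_cut i, direct_edge (partner i), apex_cut (partner i)}"
  proof (cases rule: H_edge_cases)
    case (rim_edge k)
    then show ?thesis using e(2) apex_rim_ne[OF i rim_edge(1)] apex_rim_pred_ne[OF i rim_edge(1)] by (simp add: rim_edge_def)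
  next
    case (direct_edge k)
    then have "apex k = apex i" using e(2) apex_rim_ne[OF i] by (auto simp: direct_edge_def)
    then show ?thesis using direct_edge apex_eq_apex_iff[OF i] by blast
  next
    case (apex_cut k)
    then have "apex k = apex i" using e(2) by (auto simp: apex_cut_def)
    then show ?thesis using apex_cut apex_eq_apex_iff[OF i] by blast
  next
    case (rim_cut k)
    then show ?thesis using e(2) apex_rim_ne[OF i] by (simp add: rim_cut_def)
  next
    case (inner k A)
    then show ?thesis using e(2) by auto
  qed
next
  fix e assume e: "e \<in> {direct_edge i, apex_cut i, direct_edge (partner i), apex_cut (partner i)}"
  have "apex (partner i) = apex i" using partner[OF i] apex_eq_apex_iff[OF i] by blast
  then show "e \<in> {e \<in> set_mset (edges H). B (apex i) \<in> e}"
    using e H_edges[OF i] H_edges[of "partner i"] partner[OF i]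
    by (auto simp: direct_edge_def apex_cut_def)
qed

definition next_rim_edge :: "nat \<Rightarrow> 'g hvertex set" where
  "next_rim_edge i = (if i = 8 then rim_edge 1 else rim_edge (Suc i))"

lemma rim_pred_eq_rim_iff [rule_format]: "\<forall>i\<in>{1..8}. \<forall>k\<in>{1..8}. rim (k - 1) = rim i \<longleftrightarrow> k = (if i = 8 then 1 else Suc i)"
  unfolding indices by simp

lemma edges_at_rim:
  assumes i: "i \<in> {1..8}"
  shows "{e \<in> set_mset (edges H). B (rim i) \<in> e} =
    {direct_edge i, rim_cut i, rim_edge i, next_rim_edge i}"
proof (intro equalityI subsetI)
  fix e assume "e \<in> {e \<in> set_mset (edges H). B (rim i) \<in> e}"
  then have e: "e \<in># edges H" "B (rim i) \<in> e" by auto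
  from e(1) show "e \<in> {direct_edge i, rim_cut i, rim_edge i, next_rim_edge i}"
  proof (cases rule: H_edge_cases)
    case (rim_edge k)
    then have "rim (k - 1) = rim i \<or> rim k = rim i" using e(2) by (auto simp: rim_edge_def)
    then show ?thesis
      using rim_edge rim_pred_eq_rim_iff[OF i rim_edge(1)] rim_inject[OF rim_edge(1) i]
      by (auto simp: next_rim_edge_def)
  next
    case (direct_edge k)
    then have "rim k = rim i" using e(2) apex_rim_ne[OF direct_edge(1) i] by (auto simp: direct_edge_def)
    then show ?thesis using direct_edge rim_inject[OF direct_edge(1) i] by blast
  next
    case (apex_cut k)
    then show ?thesis using e(2) apex_rim_ne[OF apex_cut(1) i] by (auto simp: apex_cut_def)
  next
    case (rim_cut k)
    then have "rim k = rim i" using e(2) by (auto simp: rim_cut_def)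
    then show ?thesis using rim_cut rim_inject[OF rim_cut(1) i] by blast
  next
    case (inner k A)
    then show ?thesis using e(2) by auto
  qed
next
  fix e assume e: "e \<in> {direct_edge i, rim_cut i, rim_edge i, next_rim_edge i}"
  have "next_rim_edge i \<in># edges H" "B (rim i) \<in> next_rim_edge i"
    using i H_edges(1)[of 1] H_edges(1)[of "Suc i"] by (auto simp: next_rim_edge_def rim_edge_def)
  then show "e \<in> {e \<in> set_mset (edges H). B (rim i) \<in> e}"
    using e H_edges[OF i] by (auto simp: direct_edge_def rim_cut_def rim_edge_def)
qed

definition gadget_verts :: "nat \<Rightarrow> 'g hvertex set" where
  "gadget_verts i = range (New (digon i))"

lemma digon_inject: "i \<in> {1..8} \<Longrightarrow> j \<in> {1..8} \<Longrightarrow> digon i = digon j \<longleftrightarrow> i = j"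
  using rim_inject by (auto simp: digon_def)

lemma edge_distinct:
  assumes "i \<in> {1..8}"
  shows "distinct [direct_edge i, apex_cut i, direct_edge (partner i), apex_cut (partner i)]"
    "distinct [direct_edge i, rim_cut i, rim_edge i, next_rim_edge i]"
proof -
  have i: "i \<in> {1, 2, 3, 4, 5, 6, 7, 8}" using assms unfolding indices .
  show "distinct [direct_edge i, apex_cut i, direct_edge (partner i), apex_cut (partner i)]"
    using i by (elim insertE emptyE; simp add: edge_defs digon_def doubleton_eq_iff)
  show "distinct [direct_edge i, rim_cut i, rim_edge i, next_rim_edge i]"
    using i by (elim insertE emptyE; simp add: edge_defs next_rim_edge_def digon_def doubleton_eq_iff flip: numeral_2_eq_2)
qed

text \<open>The last set collects possible loops in \<open>K\<close>, since a loop also meets the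
  gadget in exactly one vertex. It becomes empty once the graph is known to be simple.\<close>

lemma gadget_cut:
  assumes i: "i \<in> {1..8}"
  shows "{e \<in> set_mset (edges H). card (e \<inter> gadget_verts i) = 1} =
    {apex_cut i, rim_cut i} \<union> {e \<in> (`) (New (digon i)) ` set_mset K. card e = 1}"
proof (intro equalityI subsetI)
  fix e assume "e \<in> {e \<in> set_mset (edges H). card (e \<inter> gadget_verts i) = 1}"
  then have e: "e \<in># edges H" "card (e \<inter> gadget_verts i) = 1" by auto
  have base: "{B x, B y} \<inter> gadget_verts k = {}" for x y k by (auto simp: gadget_verts_def)
  from e(1) show "e \<in> {apex_cut i, rim_cut i} \<union> {e \<in> (`) (New (digon i)) ` set_mset K. card e = 1}"
  proof (cases rule: H_edge_cases)
    case (rim_edge k)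
    then show ?thesis using e(2) base by (simp add: rim_edge_def)
  next
    case (direct_edge k)
    then show ?thesis using e(2) base by (simp add: direct_edge_def)
  next
    case (apex_cut k)
    have "e \<inter> gadget_verts i = {}" if "k \<noteq> i"
      using that apex_cut digon_inject[OF apex_cut(1) i] by (auto simp: apex_cut_def gadget_verts_def)
    then have "k = i" using e(2) by force
    then show ?thesis using apex_cut by simp
  next
    case (rim_cut k)
    have "e \<inter> gadget_verts i = {}" if "k \<noteq> i"
      using that rim_cut digon_inject[OF rim_cut(1) i] by (auto simp: rim_cut_def gadget_verts_def)
    then have "k = i" using e(2) by force
    then show ?thesis using rim_cut by simp
  next
    case (inner k A)
    have "e \<inter> gadget_verts i = (if k = i then e else {})"
      using digon_inject[OF inner(1) i] inner(2) by (auto simp: gadget_verts_def)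
    then show ?thesis using inner e(2) by (auto split: if_splits)
  qed
next
  fix e assume "e \<in> {apex_cut i, rim_cut i} \<union> {e \<in> (`) (New (digon i)) ` set_mset K. card e = 1}"
  then consider "e = apex_cut i" | "e = rim_cut i"
    | "e \<in> (`) (New (digon i)) ` set_mset K" "card e = 1" by blast
  then show "e \<in> {e \<in> set_mset (edges H). card (e \<inter> gadget_verts i) = 1}"
  proof cases
    case 1
    then have "e \<inter> gadget_verts i = {New (digon i) gi}" by (auto simp: apex_cut_def gadget_verts_def)
    then show ?thesis using 1 H_edges[OF i] by simp
  next
    case 2
    then have "e \<inter> gadget_verts i = {New (digon i) gj}" by (auto simp: rim_cut_def gadget_verts_def)
    then show ?thesis using 2 H_edges[OF i] by simp
  next
    case 3
    then have "e \<inter> gadget_verts i = e" by (auto simp: gadget_verts_def)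
    moreover have "e \<in># edges H" unfolding set_edges_H using 3(1) i by blast
    ultimately show ?thesis using 3 by simp
  qed
qed

lemma not_circle_representable:
  assumes simple: "simple_graph H"
  shows "\<not> circle_representable H"
proof
  assume "circle_representable H"
  then obtain \<C> p where "circle_representation H \<C> p" unfolding circle_representable_def by blast
  then interpret circle_rep H \<C> p using simple by unfold_locales
  have verts: "B v \<in> V" "i \<in> {1..8} \<Longrightarrow> gadget_verts i \<subseteq> V" for v i
    unfolding verts_H gadget_verts_def by blast+
  have pi: "partner i \<in> {1..8}" "apex (partner i) = apex i" "partner (partner i) = i" "partner i \<noteq> i"
    if "i \<in> {1..8}" for i
    using that partner[of i] apex_eq_apex_iff[of i "partner i"] by auto
  have p_eq: "p u = p v \<longleftrightarrow> u = v" if "u \<in> V" "v \<in> V" for u v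
    using inj_p that by (auto dest: inj_onD)

  have cut: "circ (apex_cut i) = circ (rim_cut i)" if i: "i \<in> {1..8}" for i
  proof (rule two_edge_cut_same_circle)
    show "gadget_verts i \<subseteq> V" using verts i by blast
    have "e \<in> E" if "e \<in> (`) (New (digon i)) ` set_mset K" for e
      unfolding set_edges_H using that i by blast
    then have "{e \<in> (`) (New (digon i)) ` set_mset K. card e = 1} = {}"
      using card_edge by fastforce
    then show "{e \<in> E. card (e \<inter> gadget_verts i) = 1} = {apex_cut i, rim_cut i}"
      unfolding gadget_cut[OF i] by (simp only: Un_empty_right)
    show "apex_cut i \<noteq> rim_cut i"
      using apex_rim_ne[OF i i] by (auto simp: apex_cut_def rim_cut_def)
  qed
  have on: "p (B (rim i)) \<in> circ (direct_edge i)" "p (B (apex i)) \<in> circ (direct_edge i)"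
    "p (B (rim i)) \<in> circ (apex_cut i)" "p (B (apex i)) \<in> circ (apex_cut i)"
    "p (B (rim i)) \<in> circ (rim_edge i)"
    if i: "i \<in> {1..8}" for i
    using p_in_circ[OF H_edges(1)[OF i]] p_in_circ[OF H_edges(2)[OF i]] p_in_circ[OF H_edges(3)[OF i]]
      p_in_circ[OF H_edges(4)[OF i]] unfolding cut[OF i] by (simp_all add: edge_defs)

  text \<open>Otherwise two different circles run from \<open>rim i\<close> through the apex to the rim vertex of
    the partner, and so have three common points.\<close>

  have digon_circle: "circ (apex_cut i) = circ (direct_edge i)" if i: "i \<in> {1..8}" for i
  proof (rule ccontr)
    let ?j = "partner i"
    note j = pi(1)[OF i]
    assume ne: "circ (apex_cut i) \<noteq> circ (direct_edge i)"
    have reach: "p (B (rim ?j)) \<in> C" if C: "C \<in> {circ (apex_cut i), circ (direct_edge i)}" for C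
    proof -
      have CC: "C \<in> \<C>" "p (B (apex i)) \<in> C" using C circ H_edges[OF i] on[OF i] by auto
      have "of_bool (circ (direct_edge i) = C) + of_bool (circ (apex_cut i) = C)
          + of_bool (circ (direct_edge ?j) = C) + of_bool (circ (apex_cut ?j) = C) = (2::nat)"
        by (rule four_edges_at[OF verts(1) edges_at_apex[OF i] edge_distinct(1)[OF i] CC])
      moreover have "\<not> (circ (direct_edge i) = C \<and> circ (apex_cut i) = C)" using ne by metis
      ultimately have "circ (direct_edge ?j) = C \<or> circ (apex_cut ?j) = C"
        by (simp add: of_bool_def split: if_splits)
      then show ?thesis using on[OF j] by auto
    qed
    have "apex i \<noteq> rim i" "apex i \<noteq> rim ?j" "rim i \<noteq> rim ?j"
      using apex_rim_ne i j rim_inject[OF i j] pi(4)[OF i] by auto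
    then show False
      using card_common_le_2[of "circ (apex_cut i)" "circ (direct_edge i)"
          "p (B (apex i))" "p (B (rim i))" "p (B (rim ?j))"]
        ne circ H_edges[OF i] on[OF i] reach by (simp add: p_eq verts)
  qed

  define Kc where "Kc i = circ (direct_edge i)" for i
  have Kc: "circ (direct_edge i) = Kc i" "circ (apex_cut i) = Kc i" "circ (rim_cut i) = Kc i" "Kc i \<in> \<C>"
    if "i \<in> {1..8}" for i
    using that digon_circle cut circ H_edges by (auto simp: Kc_def)
  \<comment> \<open>At the apex the two edges of digon \<open>i\<close> already are the two edges on
    \<open>Kc i\<close>, so those of the partner digon lie on a different circle.\<close>
  have Kc_partner: "Kc (partner i) \<noteq> Kc i" if i: "i \<in> {1..8}" for i
    using four_edges_at[OF verts(1) edges_at_apex[OF i] edge_distinct(1)[OF i] Kc(4)[OF i]]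
      on(2)[OF i] Kc[OF i] Kc[OF pi(1)[OF i]] by auto
  have rim_step: "circ (rim_edge i) \<noteq> Kc i" "circ (next_rim_edge i) = circ (rim_edge i)"
    if i: "i \<in> {1..8}" for i
  proof -
    note four = four_edges_at[OF verts(1) edges_at_rim[OF i] edge_distinct(2)[OF i]]
    \<comment> \<open>At \<open>rim i\<close> the edges of digon \<open>i\<close> use up both places
      on \<open>Kc i\<close>. The two cycle edges are then left for the other circle, which they
      share.\<close>
    have "of_bool (circ (rim_edge i) = Kc i) + of_bool (circ (next_rim_edge i) = Kc i) = (0::nat)"
      using four[of "Kc i"] on(1)[OF i] Kc[OF i] by simp
    then show *: "circ (rim_edge i) \<noteq> Kc i" by auto
    have "of_bool (circ (next_rim_edge i) = circ (rim_edge i)) = (1::nat)"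
      using four[of "circ (rim_edge i)"] on(5)[OF i] Kc[OF i] *[symmetric] circ[OF H_edges(1)[OF i]]
      by simp
    then show "circ (next_rim_edge i) = circ (rim_edge i)"
      by (simp add: of_bool_def split: if_splits)
  qed
  define O' where "O' = circ (rim_edge 1)"
  have "\<forall>i\<in>{1..8}. circ (rim_edge i) = O'"
    using rim_step(2)[of 1] rim_step(2)[of 2] rim_step(2)[of 3] rim_step(2)[of 4] rim_step(2)[of 5]
      rim_step(2)[of 6] rim_step(2)[of 7]
    unfolding indices by (simp add: next_rim_edge_def O'_def eval_nat_numeral)
  then have rim_circ: "circ (rim_edge i) = O'" if "i \<in> {1..8}" for i using that by blast
  have OC: "O' \<in> \<C>" using circ H_edges(1)[of 1] by (simp add: O'_def)
  have KO: "Kc i \<noteq> O'" if "i \<in> {1..8}" for i using rim_step(1) rim_circ that by metis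

  \<comment> \<open>All vertices that \<open>Kc i\<close> could visit. Its route through the gadget
    is unknown, so the whole gadget is included; these sets overlap at most in a common apex, which
    is enough for the intersections below.\<close>
  define T where "T i = {B (apex i), B (rim i)} \<union> gadget_verts i" for i
  have Kverts: "v \<in> T i" if i: "i \<in> {1..8}" and v: "v \<in> V" "p v \<in> Kc i" for v i
  proof (rule circle_vertices_subset[OF Kc(4)[OF i] _ verts(1) _ _ v])
    show "B (rim i) \<in> T i" "p (B (rim i)) \<in> Kc i" using on(1)[OF i] Kc[OF i] by (auto simp: T_def)
    fix e assume e: "e \<in> E" "circ e = Kc i" "e \<inter> T i \<noteq> {}"
    have *: "e \<in> {direct_edge i, apex_cut i}" if "B (apex i) \<in> e"
    proof -
      have "e \<in> {direct_edge i, apex_cut i, direct_edge (partner i), apex_cut (partner i)}"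
        unfolding edges_at_apex[OF i, symmetric] using e(1) that by simp
      moreover have "e \<noteq> direct_edge (partner i)" "e \<noteq> apex_cut (partner i)"
        using e(2) Kc[OF pi(1)[OF i]] Kc_partner[OF i] by metis+
      ultimately show ?thesis by simp
    qed
    have **: "e \<in> {direct_edge i, rim_cut i}" if "B (rim i) \<in> e"
    proof -
      have "e \<in> {direct_edge i, rim_cut i, rim_edge i, next_rim_edge i}"
        unfolding edges_at_rim[OF i, symmetric] using e(1) that by simp
      moreover have "e \<noteq> rim_edge i" "e \<noteq> next_rim_edge i"
        using e(2) rim_step(2)[OF i] rim_circ[OF i] KO[OF i] by metis+
      ultimately show ?thesis by simp
    qed
    show "e \<subseteq> T i"
      using e(1)
    proof (cases rule: H_edge_cases)
      case (rim_edge k)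
      then show ?thesis using rim_circ KO[OF i] e(2) by metis
    next
      case (direct_edge k)
      then have "B (apex i) \<in> e \<or> B (rim i) \<in> e"
        using e(3) by (auto simp: T_def direct_edge_def gadget_verts_def)
      then have "e \<in> {direct_edge i, apex_cut i, rim_cut i}" using * ** by blast
      then show ?thesis by (auto simp: T_def edge_defs gadget_verts_def)
    next
      case (apex_cut k)
      then have "B (apex i) \<in> e \<or> B (rim i) \<in> e \<or> k = i"
        using e(3) digon_inject[OF apex_cut(1) i] by (auto simp: T_def apex_cut_def gadget_verts_def)
      then have "e \<in> {direct_edge i, apex_cut i, rim_cut i}" using * ** apex_cut by blast
      then show ?thesis by (auto simp: T_def edge_defs gadget_verts_def)
    next
      case (rim_cut k)
      then have "B (apex i) \<in> e \<or> B (rim i) \<in> e \<or> k = i"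
        using e(3) digon_inject[OF rim_cut(1) i] by (auto simp: T_def rim_cut_def gadget_verts_def)
      then have "e \<in> {direct_edge i, apex_cut i, rim_cut i}" using * ** rim_cut by blast
      then show ?thesis by (auto simp: T_def edge_defs gadget_verts_def)
    next
      case (inner k A)
      then have "k = i" using e(3) digon_inject[OF inner(1) i] by (auto simp: T_def gadget_verts_def)
      then show ?thesis using inner by (auto simp: T_def gadget_verts_def)
    qed
  qed
  have Overts: "v \<in> (\<lambda>i. B (rim i)) ` {1..8}" if v: "v \<in> V" "p v \<in> O'" for v
  proof (rule circle_vertices_subset[OF OC _ verts(1) _ _ v])
    show "B (rim 1) \<in> (\<lambda>i. B (rim i)) ` {1..8}" by (rule image_eqI[of _ _ 1]) auto
    show "p (B (rim 1)) \<in> O'" using on(5)[of 1] rim_circ[of 1] by simp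
    fix e assume e: "e \<in> E" "circ e = O'" "e \<inter> (\<lambda>i. B (rim i)) ` {1..8} \<noteq> {}"
    show "e \<subseteq> (\<lambda>i. B (rim i)) ` {1..8}"
      using e(1)
    proof (cases rule: H_edge_cases)
      case (rim_edge k)
      have "rim (k - 1) \<in> rim ` {1..8}" using rim_edge(1) unfolding indices by auto
      then show ?thesis using rim_edge by (auto simp: rim_edge_def)
    next
      case (inner k A)
      then show ?thesis using e(3) by auto
    qed (use e(2) Kc KO in metis)+
  qed

  define P where "P i = p (B (rim i))" for i
  have KO_int: "Kc i \<inter> O' = {P i}" if i: "i \<in> {1..8}" for i
  proof (intro equalityI subsetI)
    fix x assume x: "x \<in> Kc i \<inter> O'"
    then have "x \<in> D" using common_point_double Kc(4)[OF i] OC KO[OF i] by blast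
    then obtain v where v: "v \<in> V" "x = p v" using D_eq by auto
    then have vT: "v \<in> T i" and "v \<in> (\<lambda>i. B (rim i)) ` {1..8}" using x Kverts[OF i] Overts by auto
    then obtain j where j: "j \<in> {1..8}" "v = B (rim j)" by blast
    then have "v = B (rim i)" using vT apex_rim_ne[OF i j(1)] by (auto simp: T_def gadget_verts_def)
    then show "x \<in> {P i}" using v by (simp add: P_def)
  next
    fix x assume "x \<in> {P i}"
    then show "x \<in> Kc i \<inter> O'"
      using on[OF i] Kc[OF i] rim_circ[OF i] by (simp add: P_def)
  qed
  have KK: "Kc i \<inter> Kc j = (if apex i = apex j then {p (B (apex i))} else {})"
    if ij: "i \<in> {1..8}" "j \<in> {1..8}" "i \<noteq> j" for i j
  proof -
    have T: "T i \<inter> T j \<subseteq> (if apex i = apex j then {B (apex i)} else {})"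
      using apex_rim_ne[OF ij(1,2)] apex_rim_ne[OF ij(2,1)] rim_inject[OF ij(1,2)] digon_inject[OF ij(1,2)] ij(3)
      by (auto simp: T_def gadget_verts_def)
    have "Kc i \<noteq> Kc j"
    proof
      assume eq: "Kc i = Kc j"
      then have "B (rim j) \<in> T i" using Kverts[OF ij(1) verts(1)] on(1)[OF ij(2)] Kc[OF ij(2)] by metis
      then show False using apex_rim_ne[OF ij(1,2)] rim_inject[OF ij(1,2)] ij(3)
        by (auto simp: T_def gadget_verts_def)
    qed
    have "Kc i \<inter> Kc j \<subseteq> p ` (T i \<inter> T j)"
    proof
      fix x assume x: "x \<in> Kc i \<inter> Kc j"
      then have "x \<in> D" using common_point_double Kc(4) ij \<open>Kc i \<noteq> Kc j\<close> by blast
      then obtain v where v: "v \<in> V" "x = p v" using D_eq by auto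
      then show "x \<in> p ` (T i \<inter> T j)" using x Kverts ij by blast
    qed
    moreover have "p (B (apex i)) \<in> Kc i \<inter> Kc j" if "apex i = apex j"
      using on(2)[OF ij(1)] on(2)[OF ij(2)] Kc ij that by auto
    ultimately show ?thesis using T by (auto split: if_splits) 
  qed

  \<comment> \<open>As \<open>rim 0\<close> is \<open>V8\<close>, this edge joins \<open>V8\<close>
    and \<open>V1\<close>. Projecting from a point of its arc cuts the circle open there and leaves
    the rim vertices in the order 1 to 8.\<close>
  have E1: "rim_edge 1 \<in> E" using H_edges(1)[of 1] by simp
  obtain w where w: "w \<in> arc (rim_edge 1)" using arc_props(1)[OF E1] by blast
  then have wO: "w \<in> O'" and wD: "w \<notin> D" using arc_props(2,3)[OF E1] by (auto simp: O'_def)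
  obtain c R where cR: "R > 0" "O' = sphere c R" using circle[OF OC] by (auto simp: is_circle_def)
  have wS: "w \<in> sphere c R" using wO cR by simp
  have PO: "P i \<in> O' - {w}" "P i \<in> D" if i: "i \<in> {1..8}" for i
  proof -
    show "P i \<in> D" using D_eq verts(1) by (simp add: P_def)
    then show "P i \<in> O' - {w}" using on(5)[OF i] rim_circ[OF i] wD by (auto simp: P_def)
  qed
  have consecutive: "stereo c w (P j) \<notin> open_segment (stereo c w (P i)) (stereo c w (P (Suc i)))"
    if i: "i \<in> {1..<8}" and j: "j \<in> {1..8}" for i j
  proof
    assume in_seg: "stereo c w (P j) \<in> open_segment (stereo c w (P i)) (stereo c w (P (Suc i)))"
    let ?e = "rim_edge (Suc i)"
    have i': "Suc i \<in> {1..8}" using i by auto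
    have e: "?e \<in> E" "circ ?e = O'" using H_edges(1)[OF i'] rim_circ[OF i'] by auto
    have "?e \<noteq> rim_edge 1"
    proof
      assume "?e = rim_edge 1"
      then have "{B (rim i), B (rim (Suc i))} = {B (rim 8), B (rim 1)}" by (simp add: rim_edge_def)
      then have "rim i \<in> {rim 8, rim 1}" "rim (Suc i) \<in> {rim 8, rim 1}" by blast+
      then show False
        using i rim_inject[OF _ i', of 1] rim_inject[OF _ i', of 8] rim_inject[of i 1] rim_inject[of i 8]
        by simp
    qed
    then have "arc ?e \<noteq> arc (rim_edge 1)" using inj_arc e(1) E1 by (auto dest: inj_onD)
    then have "arc ?e \<inter> arc (rim_edge 1) = {}"
      using circ[OF e(1)] circ[OF E1] e(2) O'_def by (metis components_nonoverlap)
    \<comment> \<open>The point \<open>w\<close> lies on a different open arc and is not a double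
      point, so it is neither on the arc of \<open>?e\<close> nor one of its ends.\<close>
    then have "w \<notin> closure (arc ?e)"
      using w wD arc_props(5)[OF e(1)] edge_subset[OF e(1)] D_eq by auto
    then have clos: "closure (arc ?e) \<subseteq> sphere c R - {w}"
      using arc_props(6)[OF e(1)] e(2) cR by auto
    have "P i \<in> closure (arc ?e)" "P (Suc i) \<in> closure (arc ?e)"
      unfolding arc_props(5)[OF e(1)] by (auto simp: P_def rim_edge_def)
    then have "stereo c w (P j) \<in> stereo c w ` arc ?e"
      using stereo_open_segment_in_image[OF cR(1) wS arc_props(4)[OF e(1)] clos] in_seg by blast
    then obtain q where q: "q \<in> arc ?e" "stereo c w (P j) = stereo c w q" by auto
    then have "q \<in> sphere c R - {w}" using clos closure_subset by blast
    then have "P j = q"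
      using q(2) PO(1)[OF j] homeomorphism_apply1[OF homeomorphism_stereo[OF cR(1) wS]] cR(2) by metis
    \<comment> \<open>A double point would lie on an open arc.\<close>
    then show False using q(1) PO(2)[OF j] arc_props(3)[OF e(1)] by blast
  qed
  show False
  proof (rule no_eight_tangent_circles[OF cR(1) wS, of Kc P])
    show "is_circle (Kc i)" if "i \<in> {1..8}" for i using circle Kc(4)[OF that] by blast
    show "Kc i \<inter> sphere c R = {P i} \<and> P i \<noteq> w" if "i \<in> {1..8}" for i
      using KO_int[OF that] PO(1)[OF that] cR by auto
    show "\<exists>z. Kc i \<inter> Kc j = {z}" if "(i, j) \<in> {(1,4), (5,8), (2,7), (3,6)}" for i j
    proof -
      have "i \<in> {1..8}" "j \<in> {1..8}" "i \<noteq> j" "apex i = apex j" using that by auto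
      then show ?thesis using KK by auto
    qed
    show "Kc i \<inter> Kc j = {}"
      if "i \<in> {1..8}" "j \<in> {1..8}" "i < j" "(i, j) \<notin> {(1,4), (5,8), (2,7), (3,6)}" for i j
      using KK[OF that(1,2)] apex_eq_iff[OF that(1-3)] that by auto
    show "inj_on P {1..8}"
      using rim_inject by (auto simp: inj_on_def P_def p_eq verts)
    show "stereo c w (P j) \<notin> open_segment (stereo c w (P i)) (stereo c w (P (Suc i)))"
      if "i \<in> {1..<8}" "j \<in> {1..8}" for i j using consecutive that by blast
  qed
qed

end

section \<open>Straight-line drawings\<close>

text \<open>Twice the signed area of the triangle P Q R.\<close>

definition orientation :: "int \<times> int \<Rightarrow> int \<times> int \<Rightarrow> int \<times> int \<Rightarrow> int" where
  "orientation P Q R = (fst Q - fst P) * (snd R - snd P) - (snd Q - snd P) * (fst R - fst P)"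

text \<open>Apart from the bounding boxes, this tests whether one segment lies strictly on one side of
  the line through the other; segments with a common end must not be collinear.\<close>

fun noncrossing :: "(int \<times> int) \<times> (int \<times> int) \<Rightarrow> (int \<times> int) \<times> (int \<times> int) \<Rightarrow> bool" where
  "noncrossing (P, Q) (R, S) \<longleftrightarrow>
     max (fst P) (fst Q) < min (fst R) (fst S) \<or> max (fst R) (fst S) < min (fst P) (fst Q) \<or>
     max (snd P) (snd Q) < min (snd R) (snd S) \<or> max (snd R) (snd S) < min (snd P) (snd Q) \<or>
     (if P = R \<or> Q = R then orientation P Q S \<noteq> 0
      else if P = S \<or> Q = S then orientation P Q R \<noteq> 0
      else orientation P Q R * orientation P Q S > 0 \<or> orientation R S P * orientation R S Q > 0)"

definition emb :: "int \<times> int \<Rightarrow> real^2" where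
  "emb P = vector [of_int (fst P), of_int (snd P)]"

lemma emb_nth [simp]: "emb P $ 1 = of_int (fst P)" "emb P $ 2 = of_int (snd P)"
  by (simp_all add: emb_def)

lemma emb_eq_iff [simp]: "emb P = emb Q \<longleftrightarrow> P = Q"
  by (auto simp: vec_eq_iff forall_2 prod_eq_iff)

text \<open>The extension of \<open>orientation P Q\<close> to real points: an affine function that
  vanishes on the line through P and Q.\<close>

definition line_form :: "int \<times> int \<Rightarrow> int \<times> int \<Rightarrow> real^2 \<Rightarrow> real" where
  "line_form P Q z = of_int (fst Q - fst P) * (z $ 2 - of_int (snd P)) - of_int (snd Q - snd P) * (z $ 1 - of_int (fst P))"

lemma line_form_emb: "line_form P Q (emb R) = of_int (orientation P Q R)"
  by (simp add: line_form_def orientation_def)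

lemma line_form_segment:
  "line_form P Q ((1 - t) *\<^sub>R x + t *\<^sub>R y) = (1 - t) * line_form P Q x + t * line_form P Q y"
  by (simp add: line_form_def algebra_simps)

lemma line_form_zero:
  assumes "z \<in> closed_segment (emb P) (emb Q)"
  shows "line_form P Q z = 0"
proof -
  obtain t where "z = (1 - t) *\<^sub>R emb P + t *\<^sub>R emb Q" using assms by (auto simp: in_segment)
  then show ?thesis by (simp add: line_form_segment line_form_emb orientation_def)
qed

text \<open>On the segment from R to S the affine form takes convex combinations of two values of
  the same sign, hence never the value 0 that it has on the other segment.\<close>

lemma one_side_disjoint:
  assumes "orientation P Q R * orientation P Q S > 0"
  shows "closed_segment (emb P) (emb Q) \<inter> closed_segment (emb R) (emb S) = {}"
proof (rule ccontr)
  assume "\<not> ?thesis"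
  then obtain z where z: "z \<in> closed_segment (emb P) (emb Q)" "z \<in> closed_segment (emb R) (emb S)" by blast
  obtain t where t: "0 \<le> t" "t \<le> 1" "z = (1 - t) *\<^sub>R emb R + t *\<^sub>R emb S"
    using z(2) by (auto simp: in_segment)
  define a b where "a = real_of_int (orientation P Q R)" and "b = real_of_int (orientation P Q S)"
  have ab: "(a > 0 \<and> b > 0) \<or> (a < 0 \<and> b < 0)"
    using assms by (auto simp: a_def b_def zero_less_mult_iff)
  have "(1 - t) * a + t * b = 0"
    using line_form_zero[OF z(1)] t(3) by (simp add: line_form_segment line_form_emb a_def b_def)
  moreover have "(1 - t) * a + t * b > 0" if "a > 0" "b > 0"
    using that t by (cases "t = 0") (auto intro!: add_nonneg_pos)
  moreover have "(1 - t) * a + t * b < 0" if "a < 0" "b < 0"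
    using that t by (cases "t = 0") (auto intro!: add_nonpos_neg simp: mult_le_0_iff mult_less_0_iff)
  ultimately show False using ab by auto
qed

text \<open>The affine form vanishes at R and not at S, so on the segment between them it vanishes
  only at R.\<close>

lemma common_end_segments:
  assumes "orientation P Q S \<noteq> 0" "R = P \<or> R = Q"
  shows "closed_segment (emb P) (emb Q) \<inter> closed_segment (emb R) (emb S) \<subseteq> {emb R}"
proof
  fix z assume z: "z \<in> closed_segment (emb P) (emb Q) \<inter> closed_segment (emb R) (emb S)"
  then obtain t where t: "z = (1 - t) *\<^sub>R emb R + t *\<^sub>R emb S" by (auto simp: in_segment)
  have "orientation P Q R = 0" using assms(2) by (auto simp: orientation_def)
  then have "t * of_int (orientation P Q S) = 0"
    using line_form_zero[of z P Q] z t by (simp add: line_form_segment line_form_emb)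
  then show "z \<in> {emb R}" using assms(1) t by simp
qed

lemma noncrossing_segments:
  assumes "noncrossing (P, Q) (R, S)"
  shows "closed_segment (emb P) (emb Q) \<inter> closed_segment (emb R) (emb S) \<subseteq> emb ` ({P, Q} \<inter> {R, S})"
proof -
  let ?s = "closed_segment (emb P) (emb Q) \<inter> closed_segment (emb R) (emb S)"
  have box: "real_of_int (min (fst A) (fst B)) \<le> z $ 1 \<and> z $ 1 \<le> real_of_int (max (fst A) (fst B)) \<and>
      real_of_int (min (snd A) (snd B)) \<le> z $ 2 \<and> z $ 2 \<le> real_of_int (max (snd A) (snd B))"
    if z: "z \<in> closed_segment (emb A) (emb B)" for z A B
  proof -
    obtain t where t: "0 \<le> t" "t \<le> 1" "z = (1 - t) *\<^sub>R emb A + t *\<^sub>R emb B"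
      using z by (auto simp: in_segment)
    have "min u v \<le> (1 - t) * u + t * v \<and> (1 - t) * u + t * v \<le> max u v" for u v :: real
    proof
      have "min u v = (1 - t) * min u v + t * min u v" by (simp add: algebra_simps)
      also have "\<dots> \<le> (1 - t) * u + t * v" using t by (intro add_mono mult_left_mono) auto
      finally show "min u v \<le> (1 - t) * u + t * v" .
      have "(1 - t) * u + t * v \<le> (1 - t) * max u v + t * max u v"
        using t by (intro add_mono mult_left_mono) auto
      also have "\<dots> = max u v" by (simp add: algebra_simps)
      finally show "(1 - t) * u + t * v \<le> max u v" .
    qed
    then show ?thesis using t(3) by (simp add: of_int_min of_int_max)
  qed
  from assms consider
      "max (fst P) (fst Q) < min (fst R) (fst S) \<or> max (fst R) (fst S) < min (fst P) (fst Q) \<or>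
       max (snd P) (snd Q) < min (snd R) (snd S) \<or> max (snd R) (snd S) < min (snd P) (snd Q)"
    | "P = R \<or> Q = R" "orientation P Q S \<noteq> 0"
    | "P = S \<or> Q = S" "orientation P Q R \<noteq> 0"
    | "orientation P Q R * orientation P Q S > 0"
    | "orientation R S P * orientation R S Q > 0"
    by (auto split: if_splits)
  then show ?thesis
  proof cases
    case 1
    have "?s = {}"
    proof (rule ccontr)
      assume "?s \<noteq> {}"
      then obtain z where "z \<in> closed_segment (emb P) (emb Q)" "z \<in> closed_segment (emb R) (emb S)" by blast
      note box[OF this(1)] box[OF this(2)]
      with 1 show False by linarith
    qed
    then show ?thesis by simp
  next
    case 2
    then show ?thesis using common_end_segments[of P Q S R] by auto
  next
    case 3
    then show ?thesis using common_end_segments[of P Q R S] by (auto simp: closed_segment_commute)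
  next
    case 4
    then show ?thesis using one_side_disjoint by auto
  next
    case 5
    then show ?thesis using one_side_disjoint[of R S P Q] by auto
  qed
qed

lemma distinct_if_sorted_wrt_neq: "sorted_wrt (\<noteq>) xs \<Longrightarrow> distinct xs"
  by (induction xs) auto

text \<open>The assumptions on positions are tests on finite lists of integer pairs, so that they
  can be evaluated. \<open>sorted_wrt\<close> tests every pair of edges once, and degrees are
  counted by positions, which stand for vertices because they are distinct.\<close>

lemma graph_of_straight_line_drawing:
  fixes pos :: "'v \<Rightarrow> int \<times> int"
  assumes edges: "edges G = mset (map (\<lambda>(a, b). {a, b}) es)"
    and verts: "verts G = set vs" "\<And>a b. (a, b) \<in> set es \<Longrightarrow> {a, b} \<subseteq> set vs"
    and pos: "distinct (map pos vs)"
    and ends: "list_all (\<lambda>(P, Q). P \<noteq> Q) (map (map_prod pos pos) es)"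
    and nocross: "sorted_wrt noncrossing (map (map_prod pos pos) es)"
    and deg: "list_all (\<lambda>X. length (filter (\<lambda>(P, Q). X = P \<or> X = Q) (map (map_prod pos pos) es)) = k) (map pos vs)"
    and k: "k > 0"
  shows "simple_graph G" "regular k G" "planar G" "card (verts G) = length vs"
proof -
  let ?ends = "\<lambda>(a, b). {a, b}"
  define p where "p v = emb (pos v)" for v
  have dvs: "distinct vs" and inj_pos: "inj_on pos (set vs)" using pos by (auto simp: distinct_map)
  have p_eq: "p u = p v \<longleftrightarrow> u = v" if "u \<in> set vs" "v \<in> set vs" for u v
    using inj_pos that by (auto simp: p_def dest: inj_onD)
  have ne: "p a \<noteq> p b" "a \<noteq> b" if "(a, b) \<in> set es" for a b
    using ends that by (force simp: list_all_iff p_def)+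
  define seg where "seg e = convex hull (p ` e)" for e
  have seg: "seg {a, b} = closed_segment (p a) (p b)" for a b
    by (simp add: seg_def segment_convex_hull)
  have cross: "sorted_wrt (\<lambda>e f. seg e \<inter> seg f \<subseteq> p ` e \<inter> p ` f) (map ?ends es)"
    unfolding sorted_wrt_map
  proof (rule sorted_wrt_mono_rel[rotated])
    show "sorted_wrt (\<lambda>e f. noncrossing (map_prod pos pos e) (map_prod pos pos f)) es"
      using nocross by (simp add: sorted_wrt_map)
    fix e f assume nc: "noncrossing (map_prod pos pos e) (map_prod pos pos f)"
    obtain a b c d where ef: "e = (a, b)" "f = (c, d)" by (metis surj_pair)
    have "seg {a, b} \<inter> seg {c, d} \<subseteq> emb ` ({pos a, pos b} \<inter> {pos c, pos d})"
      using noncrossing_segments[of "pos a" "pos b" "pos c" "pos d"] nc unfolding seg p_def ef by simp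
    also have "\<dots> \<subseteq> p ` {a, b} \<inter> p ` {c, d}" by (auto simp: p_def)
    finally show "seg (?ends e) \<inter> seg (?ends f) \<subseteq> p ` ?ends e \<inter> p ` ?ends f" by (simp add: ef)
  qed
  \<comment> \<open>This is what makes the drawing rule out parallel edges: equal edges would share
    an infinite segment, but noncrossing segments meet in finitely many points.\<close>
  have inf_seg: "infinite (seg e)" if e: "e \<in> set (map ?ends es)" for e
  proof -
    obtain a b where "e = {a, b}" "p a \<noteq> p b" using e ne by auto
    then show ?thesis
      using uncountable_closed_segment[of "p a" "p b"] uncountable_infinite by (simp add: seg)
  qed
  have fin: "finite (p ` e)" if "e \<in> set (map ?ends es)" for e using that by auto
  have seg_ne: "seg e \<noteq> seg f" if "e \<in> set (map ?ends es)" "f \<in> set (map ?ends es)"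
      "seg e \<inter> seg f \<subseteq> p ` e \<inter> p ` f" for e f
    using inf_seg[OF that(1)] fin[OF that(1)] that(3) by (metis finite_subset inf.idem inf.boundedE)
  have dist_seg: "distinct (map seg (map ?ends es))"
  proof -
    have "sorted_wrt (\<lambda>e f. seg e \<noteq> seg f) (map ?ends es)"
      using cross by (rule sorted_wrt_mono_rel[rotated]) (use seg_ne in blast)
    then show ?thesis by (intro distinct_if_sorted_wrt_neq) (simp add: sorted_wrt_map)
  qed
  have dist: "distinct (map ?ends es)" using dist_seg by (auto simp: distinct_map dest: inj_on_imageI2)
  have cross': "seg e \<inter> seg f \<subseteq> p ` e \<inter> p ` f"
    if ef: "e \<in> set (map ?ends es)" "f \<in> set (map ?ends es)" "e \<noteq> f" for e f
  proof -
    let ?xs = "map ?ends es"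
    obtain i where i: "i < length ?xs" "?xs ! i = e" using ef(1) unfolding in_set_conv_nth by blast
    obtain j where j: "j < length ?xs" "?xs ! j = f" using ef(2) unfolding in_set_conv_nth by blast
    have "i \<noteq> j" using i j ef(3) by blast
    then consider "i < j" | "j < i" by linarith
    then show ?thesis
    proof cases
      case 1
      show ?thesis using sorted_wrt_nth_less[OF cross 1 j(1)] unfolding i(2) j(2) .
    next
      case 2
      show ?thesis using sorted_wrt_nth_less[OF cross 2 i(1)] unfolding i(2) j(2) by blast
    qed
  qed
  have cnt: "count (edges G) e = 1" if "e \<in># edges G" for e
    using dist that unfolding edges by (simp add: distinct_count_atmost_1)
  show simple: "simple_graph G"
    unfolding simple_graph_def verts(1)
  proof (intro conjI allI impI)
    fix e assume e: "e \<in># edges G"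
    then obtain a b where ab: "(a, b) \<in> set es" "e = {a, b}" unfolding edges by auto
    show "e \<subseteq> set vs" "card e = 2" using verts(2)[OF ab(1)] ne[OF ab(1)] ab(2) by auto
    show "count (edges G) e = 1" by (rule cnt[OF e])
  qed simp
  have degree: "length (filter (\<lambda>(a, b). v = a \<or> v = b) es) = k" if v: "v \<in> set vs" for v
  proof -
    have "filter (\<lambda>(a, b). v = a \<or> v = b) es = filter (\<lambda>(a, b). pos v = pos a \<or> pos v = pos b) es"
      using verts(2) inj_pos v by (intro filter_cong) (auto dest: inj_onD)
    moreover have "length (filter (\<lambda>(P, Q). pos v = P \<or> pos v = Q) (map (map_prod pos pos) es)) = k"
      using deg v by (simp add: list_all_iff)
    ultimately show ?thesis by (simp add: filter_map comp_def case_prod_unfold)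
  qed
  show "regular k G"
    unfolding regular_def verts(1)
  proof
    fix v assume v: "v \<in> set vs"
    have "{#e \<in># edges G. v \<in> e#} = mset (map ?ends (filter (\<lambda>(a, b). v = a \<or> v = b) es))"
      unfolding edges by (simp add: filter_mset_image_mset case_prod_unfold)
    moreover have "{#e \<in># edges G. e = {v}#} = {#}"
      unfolding set_mset_eq_empty_iff[symmetric] using simple by (auto simp: simple_graph_def)
    ultimately show "degree G v = k"
      using degree[OF v] by (simp add: degree_def del: mset_map)
  qed
  show "card (verts G) = length vs"
    using dvs by (simp add: verts(1) distinct_card)
  define path where "path = (\<lambda>(a, b). linepath (p a) (p b))"
  have path_props: "path_image (path (a, b)) = seg {a, b}" "pathstart (path (a, b)) = p a"
    "pathfinish (path (a, b)) = p b" "curve_interior (path (a, b)) = seg {a, b} - p ` {a, b}" for a b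
    by (auto simp: path_def seg curve_interior_def)
  have inj_path: "inj_on path (set es)"
  proof (rule inj_onI)
    fix e f assume ef: "e \<in> set es" "f \<in> set es" "path e = path f"
    then have "seg (?ends e) = seg (?ends f)" using path_props(1) by (metis (mono_tags, lifting) case_prod_conv surj_pair)
    moreover have "inj_on (seg \<circ> ?ends) (set es)"
      using dist_seg by (simp add: distinct_map)
    ultimately show "e = f" using ef(1,2) by (simp add: inj_on_def)
  qed
  show "planar G"
    unfolding planar_def verts(1)
  proof (intro exI[of _ p] exI[of _ "path ` set es"] conjI ballI impI)
    show "inj_on p (set vs)" using p_eq by (simp add: inj_on_def)
    show "finite (path ` set es)" by simp
  next
    fix \<gamma> assume "\<gamma> \<in> path ` set es"
    then obtain a b where ab: "(a, b) \<in> set es" "\<gamma> = path (a, b)" by auto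
    show "simple_path \<gamma>" using ne(1)[OF ab(1)] by (simp add: ab path_def simple_path_linepath)
    show "curve_interior \<gamma> \<inter> p ` set vs = {}"
    proof (rule ccontr)
      assume "curve_interior \<gamma> \<inter> p ` set vs \<noteq> {}"
      then obtain v where v: "v \<in> set vs" "p v \<in> seg {a, b}" "p v \<notin> p ` {a, b}"
        unfolding ab path_props by auto
      \<comment> \<open>Positive degree makes every vertex an end of some edge. A vertex inside a
        foreign segment is therefore already excluded by the noncrossing test on edges.\<close>
      have "filter (\<lambda>(a, b). v = a \<or> v = b) es \<noteq> []" using degree[OF v(1)] k by auto
      then obtain c d where cd: "(c, d) \<in> set es" "v \<in> {c, d}" by (auto simp: filter_empty_conv)
      then have "p v \<in> seg {c, d}" by (auto simp: seg)
      moreover have "{a, b} \<noteq> {c, d}" using cd v(3) by blast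
      ultimately show False using cross'[of "{a, b}" "{c, d}"] ab cd v by force
    qed
  next
    fix \<gamma> \<delta> assume "\<gamma> \<in> path ` set es" "\<delta> \<in> path ` set es" "\<gamma> \<noteq> \<delta>"
    then obtain a b c d where abcd: "(a, b) \<in> set es" "\<gamma> = path (a, b)" "(c, d) \<in> set es" "\<delta> = path (c, d)"
      "(a, b) \<noteq> (c, d)" by auto
    then have "{a, b} \<noteq> {c, d}" using dist by (auto simp: distinct_map inj_on_def)
    then have "seg {a, b} \<inter> seg {c, d} \<subseteq> p ` {a, b} \<inter> p ` {c, d}"
      using abcd by (intro cross') force+
    then show "curve_interior \<gamma> \<inter> curve_interior \<delta> = {}" unfolding abcd path_props by blast
  next
    have "mset_set (path ` set es) = image_mset path (mset es)"
      using inj_path dist by (simp add: distinct_map mset_set_set flip: image_mset_mset_set)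
    then show "image_mset (\<lambda>\<gamma>. {pathstart \<gamma>, pathfinish \<gamma>}) (mset_set (path ` set es)) = image_mset ((`) p) (edges G)"
      unfolding edges by (auto simp: multiset.map_comp path_props intro!: image_mset_cong)
  qed
qed

text \<open>\<open>Va\<close> and \<open>Vd\<close> lie inside the 8-cycle, \<open>Vb\<close> and
  \<open>Vc\<close> outside, matching the two sides of the circle in the argument above.\<close>

fun base_pos :: "mvertex \<Rightarrow> int \<times> int" where
  "base_pos V1 = (2, -1)" | "base_pos V2 = (4, -2)" | "base_pos V3 = (4, 2)" | "base_pos V4 = (2, 1)"
| "base_pos V5 = (-2, 1)" | "base_pos V6 = (-4, 2)" | "base_pos V7 = (-4, -2)" | "base_pos V8 = (-2, -1)"
| "base_pos Va = (1, 0)" | "base_pos Vb = (0, -4)" | "base_pos Vc = (0, 4)" | "base_pos Vd = (-1, 0)"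

text \<open>A gadget is drawn in the coordinate system in which \<open>x\<close> is \<open>(-10, 0)\<close> and \<open>y\<close> is \<open>(10, 0)\<close>;
  the factor 20 keeps all coordinates integral.\<close>

fun hvertex_pos :: "('g \<Rightarrow> int \<times> int) \<Rightarrow> 'g hvertex \<Rightarrow> int \<times> int" where
  "hvertex_pos loc (Base v) = (20 * fst (base_pos v), 20 * snd (base_pos v))"
| "hvertex_pos loc (New (x, y) g) =
    (let (x1, x2) = base_pos x; (y1, y2) = base_pos y; (s, t) = loc g
     in (10 * (x1 + y1) + s * (y1 - x1) - t * (y2 - x2), 10 * (x2 + y2) + s * (y2 - x2) + t * (y1 - x1)))"

section \<open>Vertex and edge lists of the two graphs, for evaluation\<close>

definition hvertices :: "'g list \<Rightarrow> 'g hvertex list" where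
  "hvertices gs = map Base [V1, V2, V3, V4, V5, V6, V7, V8, Va, Vb, Vc, Vd]
     @ concat (map (\<lambda>d. map (New d) gs) digons)"

definition hedges ::
    "('g hvertex \<Rightarrow> 'g hvertex \<Rightarrow> ('g \<Rightarrow> 'g hvertex) \<Rightarrow> ('g hvertex \<times> 'g hvertex) list)
      \<Rightarrow> ('g hvertex \<times> 'g hvertex) list" where
  "hedges gl = map (map_prod Base Base)
       ([(V1, V2), (V2, V3), (V3, V4), (V4, V5), (V5, V6), (V6, V7), (V7, V8), (V8, V1)] @ digons)
     @ concat (map (\<lambda>(x, y). gl (Base x) (Base y) (New (x, y))) digons)"

lemma edges_replace_digons:
  assumes "\<And>x y n. gad x y n = mset (map (\<lambda>(a, b). {a, b}) (gl x y n))"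
  shows "edges (replace_digons gad) = mset (map (\<lambda>(a, b). {a, b}) (hedges gl))"
proof -
  have "(\<Sum>(x, y)\<leftarrow>ds. gad (Base x) (Base y) (New (x, y))) =
      mset (map (\<lambda>(a, b). {a, b}) (concat (map (\<lambda>(x, y). gl (Base x) (Base y) (New (x, y))) ds)))" for ds
    by (induction ds) (auto simp: assms)
  then show ?thesis
    unfolding replace_digons_def multigraph.simps base_M_minus_digon_edges
    by (simp add: hedges_def digon_edges_def multiset.map_comp comp_def case_prod_unfold)
qed

lemma UNIV_mvertex: "UNIV = set [V1, V2, V3, V4, V5, V6, V7, V8, Va, Vb, Vc, Vd]"
  using mvertex.exhaust by auto

lemma verts_replace_digons:
  assumes "set gs = UNIV"
  shows "verts (replace_digons gad) = set (hvertices gs)"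
  using assms by (auto simp: replace_digons_def base_M_def hvertices_def UNIV_mvertex image_iff)

lemma hedges_subset_hvertices:
  assumes gl: "\<And>x y n a b. (a, b) \<in> set (gl x y n) \<Longrightarrow> {a, b} \<subseteq> {x, y} \<union> range n"
    and gs: "set gs = UNIV" and ab: "(a, b) \<in> set (hedges gl)"
  shows "{a, b} \<subseteq> set (hvertices gs)"
proof -
  have base: "Base v \<in> set (hvertices gs)" for v
    using UNIV_I[of v] unfolding UNIV_mvertex hvertices_def by auto
  have new: "New d g \<in> set (hvertices gs)" if "d \<in> set digons" for d g
    using that gs by (auto simp: hvertices_def)
  from ab consider u v where "a = Base u" "b = Base v"
    | x y where "(x, y) \<in> set digons" "(a, b) \<in> set (gl (Base x) (Base y) (New (x, y)))"
    unfolding hedges_def by auto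
  then show ?thesis
  proof cases
    case 1
    then show ?thesis using base by simp
  next
    case 2
    then show ?thesis using gl[OF 2(2)] base new[OF 2(1)] by auto
  qed
qed

definition octa_edges :: "'v \<Rightarrow> 'v \<Rightarrow> (octa_vertex \<Rightarrow> 'v) \<Rightarrow> ('v \<times> 'v) list" where
  "octa_edges x y n = [(x, n Ou), (n Ou, y),
     (n Op, n Oq'), (n Op', n Oq), (n Op', n Oq'),
     (n Op, n Or), (n Op, n Or'), (n Op', n Or), (n Op', n Or'),
     (n Oq, n Or), (n Oq, n Or'), (n Oq', n Or), (n Oq', n Or'), (n Ou, n Op), (n Ou, n Oq)]"

text \<open>With the edge between \<open>Op\<close> and \<open>Oq\<close> deleted, the quadrilateral
  \<open>Op\<close>, \<open>Or\<close>, \<open>Oq\<close>, \<open>Or'\<close> bounds the outer face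
  and encloses \<open>Op'\<close> and \<open>Oq'\<close>, so \<open>Ou\<close> can reach
  \<open>Op\<close> and \<open>Oq\<close> from below. All second coordinates are positive, which
  keeps the gadget on one side of the remaining digon edge.\<close>

fun octa_pos :: "octa_vertex \<Rightarrow> int \<times> int" where
  "octa_pos Ou = (0, 1)" | "octa_pos Op = (-4, 4)" | "octa_pos Op' = (1, 4)" | "octa_pos Oq = (4, 3)"
| "octa_pos Oq' = (-1, 3)" | "octa_pos Or = (0, 6)" | "octa_pos Or' = (0, 2)"

lemma octa_gadget_edges: "octa_gadget x y n = mset (map (\<lambda>(a, b). {a, b}) (octa_edges x y n))"
  by (simp add: octa_gadget_def octa_edges_def)

lemma octa_vertices: "set [Ou, Op, Op', Oq, Oq', Or, Or'] = UNIV"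
  using octa_vertex.exhaust by auto

definition bi_edges :: "'v \<Rightarrow> 'v \<Rightarrow> (bi_vertex \<Rightarrow> 'v) \<Rightarrow> ('v \<times> 'v) list" where
  "bi_edges x y n = [(x, n Bu), (n Bu, n Bu'), (n Bu', y),
     (n Bc1, n Bc2), (n Bc2, n Bc3), (n Bc3, n Bc4), (n Bc4, n Bc1),
     (n Bh, n Bc1), (n Bh, n Bc2), (n Bh, n Bc3), (n Bh, n Bc4),
     (n Bu, n Bc1), (n Bu, n Bc2), (n Bu', n Bc3), (n Bu', n Bc4)]"

text \<open>A wheel with hub \<open>Bh\<close> inside a rectangle, whose left side faces
  \<open>Bu\<close> and whose right side faces \<open>Bu'\<close>.\<close>

fun bi_pos :: "bi_vertex \<Rightarrow> int \<times> int" where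
  "bi_pos Bu = (-3, 1)" | "bi_pos Bu' = (3, 1)" | "bi_pos Bh = (0, 3)" | "bi_pos Bc1 = (-1, 2)"
| "bi_pos Bc2 = (-1, 5)" | "bi_pos Bc3 = (1, 5)" | "bi_pos Bc4 = (1, 2)"

lemma bi_gadget_edges: "bi_gadget x y n = mset (map (\<lambda>(a, b). {a, b}) (bi_edges x y n))"
  by (simp add: bi_gadget_def bi_edges_def)

lemma bi_vertices: "set [Bu, Bu', Bh, Bc1, Bc2, Bc3, Bc4] = UNIV"
  using bi_vertex.exhaust by auto

abbreviation "octa_pos_edges \<equiv> map (map_prod (hvertex_pos octa_pos) (hvertex_pos octa_pos)) (hedges octa_edges)"
abbreviation "bi_pos_edges \<equiv> map (map_prod (hvertex_pos bi_pos) (hvertex_pos bi_pos)) (hedges bi_edges)"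

lemma H1_drawing_vertices:
  "length (hvertices [Ou, Op, Op', Oq, Oq', Or, Or']) = 68"
  "distinct (map (hvertex_pos octa_pos) (hvertices [Ou, Op, Op', Oq, Oq', Or, Or']))"
  by code_simp+

lemma H1_drawing_ends: "list_all (\<lambda>(P, Q). P \<noteq> Q) octa_pos_edges"
  by code_simp

lemma H1_drawing_noncrossing: "sorted_wrt noncrossing octa_pos_edges"
  by code_simp

lemma H1_drawing_degrees:
  "list_all (\<lambda>X. length (filter (\<lambda>(P, Q). X = P \<or> X = Q) octa_pos_edges) = 4)
     (map (hvertex_pos octa_pos) (hvertices [Ou, Op, Op', Oq, Oq', Or, Or']))"
  by code_simp

lemma H1_drawing:
  "simple_graph H1 \<and> regular 4 H1 \<and> planar H1 \<and> card (verts H1) = 68"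
proof -
  have "{a, b} \<subseteq> {x, y} \<union> range n" if "(a, b) \<in> set (octa_edges x y n)"
    for a b x y and n :: "octa_vertex \<Rightarrow> 'v"
    using that by (auto simp: octa_edges_def)
  note drawing = graph_of_straight_line_drawing[OF edges_replace_digons[OF octa_gadget_edges]
      verts_replace_digons[OF octa_vertices] hedges_subset_hvertices[OF this octa_vertices]
      H1_drawing_vertices(2) H1_drawing_ends H1_drawing_noncrossing H1_drawing_degrees, folded H1_def]
  show ?thesis using drawing H1_drawing_vertices(1) by simp
qed

lemma H1_not_circle_representable: "\<not> circle_representable H1"
proof -
  interpret two_edge_gadget octa_gadget Ou Ou
    "{# {Op, Oq'}, {Op', Oq}, {Op', Oq'}, {Op, Or}, {Op, Or'}, {Op', Or}, {Op', Or'},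
        {Oq, Or}, {Oq, Or'}, {Oq', Or}, {Oq', Or'}, {Ou, Op}, {Ou, Oq} #}"
    by unfold_locales (simp add: octa_gadget_def)
  show ?thesis using not_circle_representable H1_drawing by (simp add: H1_def)
qed

lemma H2_drawing_vertices:
  "length (hvertices [Bu, Bu', Bh, Bc1, Bc2, Bc3, Bc4]) = 68"
  "distinct (map (hvertex_pos bi_pos) (hvertices [Bu, Bu', Bh, Bc1, Bc2, Bc3, Bc4]))"
  by code_simp+

lemma H2_drawing_ends: "list_all (\<lambda>(P, Q). P \<noteq> Q) bi_pos_edges"
  by code_simp

lemma H2_drawing_noncrossing: "sorted_wrt noncrossing bi_pos_edges"
  by code_simp

lemma H2_drawing_degrees:
  "list_all (\<lambda>X. length (filter (\<lambda>(P, Q). X = P \<or> X = Q) bi_pos_edges) = 4)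
     (map (hvertex_pos bi_pos) (hvertices [Bu, Bu', Bh, Bc1, Bc2, Bc3, Bc4]))"
  by code_simp

lemma H2_drawing:
  "simple_graph H2 \<and> regular 4 H2 \<and> planar H2 \<and> card (verts H2) = 68"
proof -
  have "{a, b} \<subseteq> {x, y} \<union> range n" if "(a, b) \<in> set (bi_edges x y n)"
    for a b x y and n :: "bi_vertex \<Rightarrow> 'v"
    using that by (auto simp: bi_edges_def)
  note drawing = graph_of_straight_line_drawing[OF edges_replace_digons[OF bi_gadget_edges]
      verts_replace_digons[OF bi_vertices] hedges_subset_hvertices[OF this bi_vertices]
      H2_drawing_vertices(2) H2_drawing_ends H2_drawing_noncrossing H2_drawing_degrees, folded H2_def]
  show ?thesis using drawing H2_drawing_vertices(1) by simp
qed

lemma H2_not_circle_representable: "\<not> circle_representable H2"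
proof -
  interpret two_edge_gadget bi_gadget Bu Bu'
    "{# {Bu, Bu'}, {Bc1, Bc2}, {Bc2, Bc3}, {Bc3, Bc4}, {Bc4, Bc1}, {Bh, Bc1}, {Bh, Bc2}, {Bh, Bc3},
        {Bh, Bc4}, {Bu, Bc1}, {Bu, Bc2}, {Bu', Bc3}, {Bu', Bc4} #}"
    by unfold_locales (simp add: bi_gadget_def)
  show ?thesis using not_circle_representable H2_drawing by (simp add: H2_def)
qed

theorem theorem3p3:
  "simple_graph H1 \<and> regular 4 H1 \<and> planar H1 \<and> card (verts H1) = 68 \<and>
   simple_graph H2 \<and> regular 4 H2 \<and> planar H2 \<and> card (verts H2) = 68 \<and>
   \<not> circle_representable H1 \<and> \<not> circle_representable H2"
  using H1_drawing H2_drawing H1_not_circle_representable H2_not_circle_representable by simp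

end
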